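(* Let $\Bbbk$ be a commutative ring and let $A$ be an augmented $\Bbbk$-algebra of finite type. Then the completion $\hat A$ is complete, and the natural map $A\to\hat A$ induces isomorphisms $$A/I(A)^n\cong\hat A/I(\hat A)^n\quad(\text{for every } n\ge1),\qquad \mathsf{Gr}(A)\cong\mathsf{Gr}(\hat A).$$ In particular, $\hat A$ is of finite type.
   Context: An augmented algebra is an associative unital $\Bbbk$-algebra $A$ with an algebra homomorphism $\varepsilon_A:A\to\Bbbk$; $I(A)=\ker\varepsilon_A$. $A$ is of finite type if $I(A)/I(A)^2$ is a finitely generated $\Bbbk$-module. The completion is $\hat A=\varprojlim_n A/I(A)^n$, an augmented algebra with the augmentation induced from $A$. An augmented algebra $A$ is complete if the natural map $A\to\hat A$ is an isomorphism (so for $\hat A$ completeness refers to powers of the ideal $I(\hat A)$). $\mathsf{Gr}(A)=\bigoplus_{n\ge0}I(A)^n/I(A)^{n+1}$ is the associated graded algebra. *)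

theory Defs
  imports "HOL-Algebra.Module" "HOL-Algebra.QuotRing" "HOL-Algebra.Ideal_Product"
begin

subsection \<open>Augmented algebras\<close>

text \<open>The library locale \<^locale>\<open>algebra\<close> only covers commutative algebras, so associative
  unital algebras are introduced here.\<close>

record ('k, 'a) aug_alg = "('k, 'a) module" +
  aug :: "'a \<Rightarrow> 'k"

locale assoc_algebra = module K A + ring A for K (structure) and A (structure) +
  assumes smult_mult_left:
      "\<lbrakk>c \<in> carrier K; x \<in> carrier A; y \<in> carrier A\<rbrakk> \<Longrightarrow>
        (c \<odot>\<^bsub>A\<^esub> x) \<otimes>\<^bsub>A\<^esub> y = c \<odot>\<^bsub>A\<^esub> (x \<otimes>\<^bsub>A\<^esub> y)"
    and smult_mult_right:
      "\<lbrakk>c \<in> carrier K; x \<in> carrier A; y \<in> carrier A\<rbrakk> \<Longrightarrow>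
        x \<otimes>\<^bsub>A\<^esub> (c \<odot>\<^bsub>A\<^esub> y) = c \<odot>\<^bsub>A\<^esub> (x \<otimes>\<^bsub>A\<^esub> y)"

locale augmented_algebra = assoc_algebra K A
  for K :: "('k, 'r) ring_scheme" (structure)
    and A :: "('k, 'a, 'm) aug_alg_scheme" (structure) +
  assumes aug_ring_hom: "aug A \<in> ring_hom A K"
    and aug_smult:
      "\<lbrakk>c \<in> carrier K; x \<in> carrier A\<rbrakk> \<Longrightarrow> aug A (c \<odot>\<^bsub>A\<^esub> x) = c \<otimes>\<^bsub>K\<^esub> aug A x"

definition alg_hom ::
  "('k, 'r) ring_scheme \<Rightarrow> ('k, 'a, 'm) module_scheme \<Rightarrow> ('k, 'b, 'n) module_scheme \<Rightarrow> ('a \<Rightarrow> 'b) set"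
  where "alg_hom K A B =
    {h \<in> ring_hom A B. \<forall>c\<in>carrier K. \<forall>x\<in>carrier A. h (c \<odot>\<^bsub>A\<^esub> x) = c \<odot>\<^bsub>B\<^esub> h x}"

definition alg_iso ::
  "('k, 'r) ring_scheme \<Rightarrow> ('k, 'a, 'm) module_scheme \<Rightarrow> ('k, 'b, 'n) module_scheme \<Rightarrow> ('a \<Rightarrow> 'b) set"
  where "alg_iso K A B = {h \<in> alg_hom K A B. bij_betw h (carrier A) (carrier B)}"

definition aug_alg_iso ::
  "('k, 'r) ring_scheme \<Rightarrow> ('k, 'a, 'm) aug_alg_scheme \<Rightarrow> ('k, 'b, 'n) aug_alg_scheme \<Rightarrow> ('a \<Rightarrow> 'b) set"
  where "aug_alg_iso K A B =
    {h \<in> alg_iso K A B. \<forall>x\<in>carrier A. aug B (h x) = aug A x}"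


subsection \<open>The augmentation ideal, its powers, and quotients\<close>

definition aug_ideal ::
  "('k, 'r) ring_scheme \<Rightarrow> ('k, 'a, 'm) aug_alg_scheme \<Rightarrow> 'a set"
  where "aug_ideal K A = a_kernel A K (aug A)"

primrec aug_pow ::
  "('k, 'r) ring_scheme \<Rightarrow> ('k, 'a, 'm) aug_alg_scheme \<Rightarrow> nat \<Rightarrow> 'a set"
  where
    "aug_pow K A 0 = carrier A"
  | "aug_pow K A (Suc n) = aug_pow K A n \<cdot>\<^bsub>A\<^esub> aug_ideal K A"

text \<open>The \<open>K\<close>-module \<open>N/P\<close> for submodules \<open>P \<subseteq> N\<close> of \<open>A\<close>. The multiplicative fields are only
  meaningful when \<open>N\<close> is all of \<open>A\<close> and \<open>P\<close> is a two-sided ideal; then \<open>N/P\<close> is the quotient ring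
  \<open>A Quot P\<close> of the library together with its \<open>K\<close>-action.\<close>

definition subquot ::
  "('k, 'a, 'm) module_scheme \<Rightarrow> 'a set \<Rightarrow> 'a set \<Rightarrow> ('k, 'a set) module"
  where "subquot A N P =
    \<lparr>carrier = (\<lambda>x. P +>\<^bsub>A\<^esub> x) ` N,
     mult = mult (A Quot P), one = one (A Quot P),
     zero = zero (A Quot P), add = add (A Quot P),
     smult = (\<lambda>c X. \<Union>x\<in>X. P +>\<^bsub>A\<^esub> (c \<odot>\<^bsub>A\<^esub> x))\<rparr>"

definition alg_quot ::
  "('k, 'a, 'm) module_scheme \<Rightarrow> 'a set \<Rightarrow> ('k, 'a set) module"
  where "alg_quot A P = subquot A (carrier A) P"

text \<open>The map that \<open>h : A \<rightarrow> B\<close> induces from cosets in \<open>A\<close> to cosets of \<open>Q\<close> in \<open>B\<close>, sending the class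
  of \<open>x\<close> to the class of \<open>h x\<close>. The union runs over all representatives; it is a single coset of \<open>Q\<close>
  exactly when the class of \<open>h x\<close> does not depend on the representative
  (see \<open>quot_map_coset\<close> below).\<close>

definition quot_map ::
  "('b, 'n) ring_scheme \<Rightarrow> 'b set \<Rightarrow> ('a \<Rightarrow> 'b) \<Rightarrow> 'a set \<Rightarrow> 'b set"
  where "quot_map B Q h X = (\<Union>x\<in>X. Q +>\<^bsub>B\<^esub> h x)"

lemma quot_map_coset:
  assumes "ring A" "ring B" "h \<in> ring_hom A B" "ideal P A" "ideal Q B" "h ` P \<subseteq> Q" "x \<in> carrier A"
  shows "quot_map B Q h (P +>\<^bsub>A\<^esub> x) = Q +>\<^bsub>B\<^esub> h x"
proof -
  interpret A: ring A by fact
  interpret B: ring B by fact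
  interpret P: ideal P A by fact
  interpret Q: ideal Q B by fact
  have hx: "h x \<in> carrier B"
    using assms(3,7) by (rule ring_hom_closed)
  have 1: "Q +>\<^bsub>B\<^esub> h y = Q +>\<^bsub>B\<^esub> h x" if y: "y \<in> P +>\<^bsub>A\<^esub> x" for y
  proof -
    obtain p where p: "p \<in> P" "y = p \<oplus>\<^bsub>A\<^esub> x"
      using y by (auto simp: a_r_coset_def')
    have "h y = h p \<oplus>\<^bsub>B\<^esub> h x"
      using p assms(3,7) P.a_subset by (auto intro: ring_hom_add)
    moreover have "h p \<in> Q"
      using p assms(6) by auto
    ultimately have "h y \<in> Q +>\<^bsub>B\<^esub> h x"
      by (auto simp: a_r_coset_def')
    then show ?thesis
      using hx B.a_repr_independence Q.a_subgroup Q.is_additive_subgroup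
      by (metis B.a_repr_independence)
  qed
  have 2: "x \<in> P +>\<^bsub>A\<^esub> x"
    using P.a_rcos_self assms(7) by blast
  show ?thesis
    unfolding quot_map_def using 1 2 by blast
qed


subsection \<open>Finite type\<close>

definition fin_gen_module ::
  "('k, 'r) ring_scheme \<Rightarrow> ('k, 'a, 'm) module_scheme \<Rightarrow> bool"
  where "fin_gen_module K M \<longleftrightarrow>
    (\<exists>S. finite S \<and> S \<subseteq> carrier M \<and>
      (\<forall>x\<in>carrier M. \<exists>c. c \<in> S \<rightarrow> carrier K \<and> x = (\<Oplus>\<^bsub>M\<^esub>s\<in>S. c s \<odot>\<^bsub>M\<^esub> s)))"

definition finite_type ::
  "('k, 'r) ring_scheme \<Rightarrow> ('k, 'a, 'm) aug_alg_scheme \<Rightarrow> bool"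
  where "finite_type K A \<longleftrightarrow>
    augmented_algebra K A \<and> fin_gen_module K (subquot A (aug_ideal K A) (aug_pow K A 2))"


subsection \<open>Completion\<close>

text \<open>The inverse limit consists of the sequences of cosets \<open>f n \<in> A/I\<^sup>n\<close> compatible with the
  projections \<open>A/I\<^sup>n\<^sup>+\<^sup>1 \<rightarrow> A/I\<^sup>n\<close>; the index \<open>n = 0\<close> only contributes the zero ring. The augmentation
  is \<open>f \<mapsto> \<epsilon>(x)\<close> for any representative \<open>x\<close> of \<open>f 1 \<in> A/I\<close>.\<close>

definition completion ::
  "('k, 'r) ring_scheme \<Rightarrow> ('k, 'a, 'm) aug_alg_scheme \<Rightarrow> ('k, nat \<Rightarrow> 'a set) aug_alg"
  where "completion K A =
    \<lparr>carrier = {f. (\<forall>n. f n \<in> carrier (alg_quot A (aug_pow K A n))) \<and>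
                   (\<forall>n. quot_map A (aug_pow K A n) (\<lambda>x. x) (f (Suc n)) = f n)},
     mult = (\<lambda>f g n. f n \<otimes>\<^bsub>alg_quot A (aug_pow K A n)\<^esub> g n),
     one = (\<lambda>n. \<one>\<^bsub>alg_quot A (aug_pow K A n)\<^esub>),
     zero = (\<lambda>n. \<zero>\<^bsub>alg_quot A (aug_pow K A n)\<^esub>),
     add = (\<lambda>f g n. f n \<oplus>\<^bsub>alg_quot A (aug_pow K A n)\<^esub> g n),
     smult = (\<lambda>c f n. c \<odot>\<^bsub>alg_quot A (aug_pow K A n)\<^esub> f n),
     aug = (\<lambda>f. the_elem (aug A ` f 1))\<rparr>"

definition completion_map ::
  "('k, 'r) ring_scheme \<Rightarrow> ('k, 'a, 'm) aug_alg_scheme \<Rightarrow> 'a \<Rightarrow> nat \<Rightarrow> 'a set"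
  where "completion_map K A a = (\<lambda>n. aug_pow K A n +>\<^bsub>A\<^esub> a)"

definition complete_aug_alg ::
  "('k, 'r) ring_scheme \<Rightarrow> ('k, 'a, 'm) aug_alg_scheme \<Rightarrow> bool"
  where "complete_aug_alg K A \<longleftrightarrow>
    augmented_algebra K A \<and> completion_map K A \<in> aug_alg_iso K A (completion K A)"


subsection \<open>The associated graded algebra\<close>

definition gr_piece ::
  "('k, 'r) ring_scheme \<Rightarrow> ('k, 'a, 'm) aug_alg_scheme \<Rightarrow> nat \<Rightarrow> ('k, 'a set) module"
  where "gr_piece K A n = subquot A (aug_pow K A n) (aug_pow K A (Suc n))"

text \<open>An element of the direct sum is a finitely supported family \<open>f n \<in> I\<^sup>n/I\<^sup>n\<^sup>+\<^sup>1\<close>. The product of the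
  classes of \<open>x \<in> I\<^sup>i\<close> and \<open>y \<in> I\<^sup>j\<close> is the class of \<open>x y\<close> modulo the \<open>(i + j + 1)\<close>-st power;
  \<^const>\<open>rcoset_mult\<close> makes sense here although the two factors are cosets of different ideals.\<close>

definition gr_alg ::
  "('k, 'r) ring_scheme \<Rightarrow> ('k, 'a, 'm) aug_alg_scheme \<Rightarrow> ('k, nat \<Rightarrow> 'a set) module"
  where "gr_alg K A =
    \<lparr>carrier = {f. (\<forall>n. f n \<in> carrier (gr_piece K A n)) \<and>
                   finite {n. f n \<noteq> \<zero>\<^bsub>gr_piece K A n\<^esub>}},
     mult = (\<lambda>f g n. \<Oplus>\<^bsub>gr_piece K A n\<^esub>i\<in>{..n}.
                      rcoset_mult A (aug_pow K A (Suc n)) (f i) (g (n - i))),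
     one = (\<lambda>n. if n = 0 then aug_pow K A 1 +>\<^bsub>A\<^esub> \<one>\<^bsub>A\<^esub> else \<zero>\<^bsub>gr_piece K A n\<^esub>),
     zero = (\<lambda>n. \<zero>\<^bsub>gr_piece K A n\<^esub>),
     add = (\<lambda>f g n. f n \<oplus>\<^bsub>gr_piece K A n\<^esub> g n),
     smult = (\<lambda>c f n. c \<odot>\<^bsub>gr_piece K A n\<^esub> f n)\<rparr>"

definition gr_map ::
  "('k, 'r) ring_scheme \<Rightarrow> ('k, 'b, 'n) aug_alg_scheme \<Rightarrow> ('a \<Rightarrow> 'b) \<Rightarrow>
    (nat \<Rightarrow> 'a set) \<Rightarrow> nat \<Rightarrow> 'b set"
  where "gr_map K B h f = (\<lambda>n. quot_map B (aug_pow K B (Suc n)) h (f n))"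

end

theory Submission
  imports Defs
begin

text \<open>Let \<open>J\<^sub>n\<close> be the kernel of the projection from the completion to \<open>A/I\<^sup>n\<close>. The natural map
  pulls \<open>J\<^sub>n\<close> back to \<open>I\<^sup>n\<close> and its image is dense for the filtration by the \<open>J\<^sub>n\<close>, and the completion
  is complete for this filtration. So everything follows once \<open>J\<^sub>n\<close> is the \<open>n\<close>-th power of the
  augmentation ideal of the completion. If \<open>r\<^sub>t\<close> are finitely many generators of \<open>I\<close> modulo \<open>I\<^sup>2\<close>, every
  element of \<open>I\<^sup>m\<^sup>+\<^sup>1\<close> is \<open>\<Sum>\<^sub>t e\<^sub>t r\<^sub>t\<close> modulo \<open>I\<^sup>m\<^sup>+\<^sup>2\<close> with \<open>e\<^sub>t \<in> I\<^sup>m\<close>; iterating this, an element of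
  \<open>J\<^sub>n\<^sub>+\<^sub>1\<close> is \<open>\<Sum>\<^sub>t u\<^sub>t r\<^sub>t\<close> with \<open>u\<^sub>t \<in> J\<^sub>n\<close>, whence \<open>J\<^sub>n\<^sub>+\<^sub>1 = J\<^sub>n J\<^sub>1\<close>. Finiteness is needed for
  the sum over \<open>t\<close> to make sense in the completion.\<close>

section \<open>Finite sums under additive maps\<close>

text \<open>Additivity is asked only on \<open>D\<close> because the coset map is applied as a map
  from \<open>I\<close> to \<open>I/I^2\<close>, and it need not land there on all of
  \<open>A\<close>. Membership of the sum in \<open>D\<close> is proved along with the formula,
  since the induction step applies additivity to the partial sum; for the identity map it is the
  closure of \<open>D\<close> under finite sums.\<close>

lemma finsum_hom_on:
  assumes G: "abelian_monoid G" and H: "abelian_monoid H"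
    and D: "D \<subseteq> carrier G" "\<zero>\<^bsub>G\<^esub> \<in> D" "\<And>x y. x \<in> D \<Longrightarrow> y \<in> D \<Longrightarrow> x \<oplus>\<^bsub>G\<^esub> y \<in> D"
    and h: "\<And>x. x \<in> D \<Longrightarrow> h x \<in> carrier H" "h \<zero>\<^bsub>G\<^esub> = \<zero>\<^bsub>H\<^esub>"
      "\<And>x y. x \<in> D \<Longrightarrow> y \<in> D \<Longrightarrow> h (x \<oplus>\<^bsub>G\<^esub> y) = h x \<oplus>\<^bsub>H\<^esub> h y"
    and "finite T" "f \<in> T \<rightarrow> D"
  shows "(\<Oplus>\<^bsub>G\<^esub>t\<in>T. f t) \<in> D \<and> h (\<Oplus>\<^bsub>G\<^esub>t\<in>T. f t) = (\<Oplus>\<^bsub>H\<^esub>t\<in>T. h (f t))"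
  using assms(9,10)
proof (induction T rule: finite_induct)
  case empty
  then show ?case
    using D h by (simp add: abelian_monoid.finsum_empty[OF G] abelian_monoid.finsum_empty[OF H])
next
  case (insert t T)
  interpret G: abelian_monoid G by (rule G)
  interpret H: abelian_monoid H by (rule H)
  have f: "f \<in> T \<rightarrow> D" "f t \<in> D"
    using insert by auto
  then have "f \<in> T \<rightarrow> carrier G" "f t \<in> carrier G" "(\<lambda>t. h (f t)) \<in> T \<rightarrow> carrier H"
    using D(1) h(1) by blast+
  then show ?case
    using insert f D h by simp
qed

lemma finsum_hom:
  assumes "abelian_monoid G" "abelian_monoid H"
    and "\<And>x. x \<in> carrier G \<Longrightarrow> h x \<in> carrier H" "h \<zero>\<^bsub>G\<^esub> = \<zero>\<^bsub>H\<^esub>"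
    and "\<And>x y. x \<in> carrier G \<Longrightarrow> y \<in> carrier G \<Longrightarrow> h (x \<oplus>\<^bsub>G\<^esub> y) = h x \<oplus>\<^bsub>H\<^esub> h y"
    and "finite T" "f \<in> T \<rightarrow> carrier G"
  shows "h (\<Oplus>\<^bsub>G\<^esub>t\<in>T. f t) = (\<Oplus>\<^bsub>H\<^esub>t\<in>T. h (f t))"
  using finsum_hom_on[of G H "carrier G" h T f] assms abelian_monoid.zero_closed[OF assms(1)]
    abelian_monoid.a_closed[OF assms(1)] by blast

lemma (in additive_subgroup) finsum_mem:
  assumes "abelian_monoid G" "finite T" "f \<in> T \<rightarrow> H"
  shows "(\<Oplus>\<^bsub>G\<^esub>t\<in>T. f t) \<in> H"
  using finsum_hom_on[of G G H "\<lambda>x. x" T f] assms a_subset by auto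

subsection \<open>Quotients of associative algebras\<close>

lemma carrier_subquot [simp]: "carrier (subquot A N P) = (\<lambda>x. P +>\<^bsub>A\<^esub> x) ` N"
  and zero_subquot [simp]: "\<zero>\<^bsub>subquot A N P\<^esub> = P"
  and one_subquot [simp]: "\<one>\<^bsub>subquot A N P\<^esub> = P +>\<^bsub>A\<^esub> \<one>\<^bsub>A\<^esub>"
  by (simp_all add: subquot_def FactRing_def)

context assoc_algebra
begin

text \<open>The scalar \<open>c\<close> acts as left multiplication by its multiple of the unit, so
  a ring ideal absorbs scalars as well.\<close>

lemma ideal_smult_closed:
  assumes "ideal P A" "c \<in> carrier K" "x \<in> P"
  shows "c \<odot>\<^bsub>A\<^esub> x \<in> P"
proof -
  interpret P: ideal P A by fact
  have "c \<odot>\<^bsub>A\<^esub> x = (c \<odot>\<^bsub>A\<^esub> \<one>\<^bsub>A\<^esub>) \<otimes>\<^bsub>A\<^esub> x"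
    using assms smult_mult_left[of c "\<one>\<^bsub>A\<^esub>" x] by simp
  then show ?thesis
    using assms P.I_l_closed by simp
qed

lemma ideal_minus_closed:
  assumes "ideal P A" "x \<in> P" "y \<in> P"
  shows "x \<ominus>\<^bsub>A\<^esub> y \<in> P"
  using assms by (simp add: a_minus_def additive_subgroup.a_closed additive_subgroup.a_inv_closed
      ideal.axioms(1))

lemma ideal_mem_minus_iff:
  assumes "ideal P A" "x \<in> carrier A" "y \<in> carrier A" "x \<ominus>\<^bsub>A\<^esub> y \<in> P"
  shows "x \<in> P \<longleftrightarrow> y \<in> P"
proof
  assume "x \<in> P"
  moreover have "y = x \<ominus>\<^bsub>A\<^esub> (x \<ominus>\<^bsub>A\<^esub> y)"
    using assms by algebra
  ultimately show "y \<in> P"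
    using assms ideal_minus_closed by metis
next
  assume "y \<in> P"
  moreover have "x = (x \<ominus>\<^bsub>A\<^esub> y) \<oplus>\<^bsub>A\<^esub> y"
    using assms by algebra
  ultimately show "x \<in> P"
    using assms additive_subgroup.a_closed ideal.axioms(1) by metis
qed

lemma coset_eq_iff:
  assumes "ideal P A" "x \<in> carrier A" "y \<in> carrier A"
  shows "P +>\<^bsub>A\<^esub> x = P +>\<^bsub>A\<^esub> y \<longleftrightarrow> x \<ominus>\<^bsub>A\<^esub> y \<in> P"
  using assms quotient_eq_iff_same_a_r_cos by blast

lemma coset_eq_ideal_iff:
  assumes "ideal P A" "x \<in> carrier A"
  shows "P +>\<^bsub>A\<^esub> x = P \<longleftrightarrow> x \<in> P"
  using assms by (metis a_rcos_zero ideal.rcos_const_imp_mem)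

lemma smult_minus:
  assumes "c \<in> carrier K" "x \<in> carrier A" "y \<in> carrier A"
  shows "c \<odot>\<^bsub>A\<^esub> (x \<ominus>\<^bsub>A\<^esub> y) = c \<odot>\<^bsub>A\<^esub> x \<ominus>\<^bsub>A\<^esub> c \<odot>\<^bsub>A\<^esub> y"
  using assms by (simp add: a_minus_def smult_r_distr smult_r_minus)

lemma subquot_add:
  assumes "ideal P A" "x \<in> carrier A" "y \<in> carrier A"
  shows "(P +>\<^bsub>A\<^esub> x) \<oplus>\<^bsub>subquot A N P\<^esub> (P +>\<^bsub>A\<^esub> y) = P +>\<^bsub>A\<^esub> (x \<oplus>\<^bsub>A\<^esub> y)"
  using assms by (simp add: subquot_def FactRing_def ideal.a_rcos_sum)

lemma subquot_mult:
  assumes "ideal P A" "x \<in> carrier A" "y \<in> carrier A"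
  shows "(P +>\<^bsub>A\<^esub> x) \<otimes>\<^bsub>subquot A N P\<^esub> (P +>\<^bsub>A\<^esub> y) = P +>\<^bsub>A\<^esub> (x \<otimes>\<^bsub>A\<^esub> y)"
  using assms by (simp add: subquot_def FactRing_def ideal.rcoset_mult_add)

lemma subquot_smult:
  assumes "ideal P A" "c \<in> carrier K" "x \<in> carrier A"
  shows "c \<odot>\<^bsub>subquot A N P\<^esub> (P +>\<^bsub>A\<^esub> x) = P +>\<^bsub>A\<^esub> (c \<odot>\<^bsub>A\<^esub> x)"
proof -
  interpret P: ideal P A by fact
  \<comment> \<open>The scalar action on cosets is a union over all representatives; it is a single
    coset because every representative gives the same one.\<close>
  have "P +>\<^bsub>A\<^esub> (c \<odot>\<^bsub>A\<^esub> y) = P +>\<^bsub>A\<^esub> (c \<odot>\<^bsub>A\<^esub> x)" if "y \<in> P +>\<^bsub>A\<^esub> x" for y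
  proof -
    have y: "y \<in> carrier A" "P +>\<^bsub>A\<^esub> y = P +>\<^bsub>A\<^esub> x"
      using that assms P.a_elemrcos_carrier P.a_repr_independence' by auto
    then have "c \<odot>\<^bsub>A\<^esub> (y \<ominus>\<^bsub>A\<^esub> x) \<in> P"
      using assms coset_eq_iff ideal_smult_closed by blast
    then show ?thesis
      using assms y by (simp add: coset_eq_iff smult_minus)
  qed
  moreover have "x \<in> P +>\<^bsub>A\<^esub> x"
    using assms P.a_rcos_self by blast
  ultimately have "(\<Union>y\<in>P +>\<^bsub>A\<^esub> x. P +>\<^bsub>A\<^esub> (c \<odot>\<^bsub>A\<^esub> y)) = P +>\<^bsub>A\<^esub> (c \<odot>\<^bsub>A\<^esub> x)"
    by blast
  then show ?thesis
    by (simp add: subquot_def)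
qed

lemmas subquot_ops = subquot_add subquot_mult subquot_smult

lemma subquot_module:
  assumes "ideal N A" "ideal P A"
  shows "module K (subquot A N P)"
proof -
  interpret N: ideal N A by fact
  interpret P: ideal P A by fact
  have P0: "P +>\<^bsub>A\<^esub> \<zero>\<^bsub>A\<^esub> = P"
    using assms coset_eq_ideal_iff[of P "\<zero>\<^bsub>A\<^esub>"] by simp
  show ?thesis
  proof (rule moduleI)
    show "cring K"
      by (rule R.cring_axioms)
    show "abelian_group (subquot A N P)"
    proof (rule abelian_groupI)
      show "\<zero>\<^bsub>subquot A N P\<^esub> \<in> carrier (subquot A N P)"
        using P0 N.zero_closed by (metis carrier_subquot imageI zero_subquot)
    next
      fix X assume "X \<in> carrier (subquot A N P)"
      then obtain x where x: "x \<in> N" "X = P +>\<^bsub>A\<^esub> x"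
        by auto
      then show "\<zero>\<^bsub>subquot A N P\<^esub> \<oplus>\<^bsub>subquot A N P\<^esub> X = X"
        using assms N.a_Hcarr subquot_add[of P "\<zero>\<^bsub>A\<^esub>" x N] by (simp add: P0)
      have "(P +>\<^bsub>A\<^esub> (\<ominus>\<^bsub>A\<^esub> x)) \<oplus>\<^bsub>subquot A N P\<^esub> X = \<zero>\<^bsub>subquot A N P\<^esub>"
        using x assms N.a_Hcarr P0 by (simp add: subquot_add M.l_neg)
      then show "\<exists>Y\<in>carrier (subquot A N P). Y \<oplus>\<^bsub>subquot A N P\<^esub> X = \<zero>\<^bsub>subquot A N P\<^esub>"
        using x N.a_inv_closed by auto
    qed (use assms in \<open>auto simp: subquot_add N.a_Hcarr N.a_closed M.a_ac\<close>)
  qed (use assms in \<open>auto simp: subquot_ops N.a_Hcarr N.a_closed ideal_smult_closed smult_l_distr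
         smult_r_distr smult_assoc1\<close>)
qed

lemma alg_quot_assoc_algebra:
  assumes "ideal P A"
  shows "assoc_algebra K (alg_quot A P)"
proof -
  interpret P: ideal P A by fact
  have N: "ideal (carrier A) A"
    by (rule oneideal)
  have mod: "module K (alg_quot A P)"
    unfolding alg_quot_def using N assms by (rule subquot_module)
  have "ring (alg_quot A P)"
  proof (rule ringI)
    show "abelian_group (alg_quot A P)"
      using mod by (rule module.axioms)
    show "monoid (alg_quot A P)"
      unfolding alg_quot_def
      by (rule monoidI) (use assms in \<open>auto simp: subquot_mult m_assoc\<close>)
  qed (use assms in \<open>auto simp: alg_quot_def subquot_ops l_distr r_distr\<close>)
  then show ?thesis
    using mod by (intro assoc_algebra.intro assoc_algebra_axioms.intro)
      (use assms in \<open>auto simp: alg_quot_def subquot_ops smult_mult_left smult_mult_right\<close>)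
qed

end

subsection \<open>Powers of the augmentation ideal\<close>

declare aug_pow.simps(2) [simp del]

context augmented_algebra
begin

lemma aug_ring_hom_ring: "ring_hom_ring A K (aug A)"
  by (rule ring_hom_ringI2) (use aug_ring_hom ring_axioms R.ring_axioms in auto)

lemma ideal_aug_ideal: "ideal (aug_ideal K A) A"
  unfolding aug_ideal_def using aug_ring_hom_ring by (rule ring_hom_ring.kernel_is_ideal)

lemma mem_aug_ideal_iff: "x \<in> aug_ideal K A \<longleftrightarrow> x \<in> carrier A \<and> aug A x = \<zero>\<^bsub>K\<^esub>"
  by (simp add: aug_ideal_def a_kernel_def')

lemma ideal_aug_pow: "ideal (aug_pow K A n) A"
  by (induction n) (simp_all add: aug_pow.simps(2) oneideal ideal_prod_is_ideal ideal_aug_ideal)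

lemma aug_pow_closed: "x \<in> aug_pow K A n \<Longrightarrow> x \<in> carrier A"
  using ideal_aug_pow ideal.Icarr by metis

lemma aug_pow_Suc_subset: "aug_pow K A (Suc n) \<subseteq> aug_pow K A n"
  using ideal_prod_inter[OF ideal_aug_pow ideal_aug_ideal] by (auto simp: aug_pow.simps(2))

lemma aug_pow_antimono: "m \<le> n \<Longrightarrow> aug_pow K A n \<subseteq> aug_pow K A m"
  using aug_pow_Suc_subset by (rule lift_Suc_antimono_le)

lemma aug_pow_1: "aug_pow K A (Suc 0) = aug_ideal K A"
proof
  show "aug_pow K A (Suc 0) \<subseteq> aug_ideal K A"
    using ideal_prod_inter[OF oneideal ideal_aug_ideal] by (auto simp: aug_pow.simps(2))
  show "aug_ideal K A \<subseteq> aug_pow K A (Suc 0)"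
  proof
    fix x assume x: "x \<in> aug_ideal K A"
    \<comment> \<open>By the recursion the first power is the product of \<open>A\<close> with the
      augmentation ideal, so \<open>x\<close> enters it as one times \<open>x\<close>.\<close>
    then have "\<one>\<^bsub>A\<^esub> \<otimes>\<^bsub>A\<^esub> x \<in> aug_pow K A (Suc 0)"
      by (auto simp: aug_pow.simps(2) intro: ideal_prod.prod)
    then show "x \<in> aug_pow K A (Suc 0)"
      using x by (simp add: mem_aug_ideal_iff)
  qed
qed

lemmas aug_pow_add_closed = additive_subgroup.a_closed[OF ideal.axioms(1)[OF ideal_aug_pow]]
  and aug_pow_inv_closed = additive_subgroup.a_inv_closed[OF ideal.axioms(1)[OF ideal_aug_pow]]
  and aug_pow_zero_closed = additive_subgroup.zero_closed[OF ideal.axioms(1)[OF ideal_aug_pow]]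
  and aug_pow_smult_closed = ideal_smult_closed[OF ideal_aug_pow]
  and aug_pow_finsum_closed =
    additive_subgroup.finsum_mem[OF ideal.axioms(1)[OF ideal_aug_pow] abelian_monoid_axioms]

text \<open>The recursion multiplies by \<open>I\<close> on the right, hence the induction on
  \<open>j\<close>: for a generator \<open>u v\<close> of \<open>I^j I\<close>, associativity turns
  \<open>x (u v)\<close> into \<open>(x u) v\<close> with \<open>x u\<close> in
  \<open>I^(i+j)\<close>. The inner induction on the ideal product also covers sums of such
  generators.\<close>

lemma aug_pow_mult_closed:
  assumes "x \<in> aug_pow K A i" "y \<in> aug_pow K A j"
  shows "x \<otimes>\<^bsub>A\<^esub> y \<in> aug_pow K A (i + j)"
  using assms(2)
proof (induction j arbitrary: y)
  case 0
  then show ?case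
    using assms ideal.I_r_closed[OF ideal_aug_pow] by simp
next
  case (Suc j)
  have "y \<in> aug_pow K A j \<cdot>\<^bsub>A\<^esub> aug_ideal K A"
    using Suc.prems by (simp add: aug_pow.simps(2))
  then show ?case
  proof (induction y rule: ideal_prod.induct)
    case (prod u v)
    then have "(x \<otimes>\<^bsub>A\<^esub> u) \<otimes>\<^bsub>A\<^esub> v \<in> aug_pow K A (Suc (i + j))"
      using Suc.IH by (simp add: aug_pow.simps(2) ideal_prod.prod)
    then show ?case
      using prod assms by (simp add: m_assoc aug_pow_closed mem_aug_ideal_iff)
  next
    case (sum u v)
    then have "u \<in> carrier A" "v \<in> carrier A"
      using aug_pow_closed[of _ "Suc j"] by (auto simp: aug_pow.simps(2))
    then show ?case
      using sum assms aug_pow_add_closed by (simp add: r_distr aug_pow_closed)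
  qed
qed

text \<open>This makes the graded product well defined: replacing \<open>x\<close> by
  \<open>p + x\<close> and \<open>y\<close> by \<open>b = q + y\<close> changes the product by
  \<open>p b + x q\<close>, and each term gains one power from \<open>p\<close> or
  \<open>q\<close>.\<close>

lemma rcoset_mult_aug_pow:
  assumes x: "x \<in> aug_pow K A i" and y: "y \<in> aug_pow K A j"
  shows "rcoset_mult A (aug_pow K A (Suc (i + j)))
      (aug_pow K A (Suc i) +>\<^bsub>A\<^esub> x) (aug_pow K A (Suc j) +>\<^bsub>A\<^esub> y)
    = aug_pow K A (Suc (i + j)) +>\<^bsub>A\<^esub> (x \<otimes>\<^bsub>A\<^esub> y)"
proof -
  let ?I = "aug_pow K A"
  have xy: "x \<in> carrier A" "y \<in> carrier A"
    using x y aug_pow_closed by auto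
  have 1: "?I (Suc (i + j)) +>\<^bsub>A\<^esub> (a \<otimes>\<^bsub>A\<^esub> b) = ?I (Suc (i + j)) +>\<^bsub>A\<^esub> (x \<otimes>\<^bsub>A\<^esub> y)"
    if "a \<in> ?I (Suc i) +>\<^bsub>A\<^esub> x" "b \<in> ?I (Suc j) +>\<^bsub>A\<^esub> y" for a b
  proof -
    obtain p q where pq: "p \<in> ?I (Suc i)" "q \<in> ?I (Suc j)" "a = p \<oplus>\<^bsub>A\<^esub> x" "b = q \<oplus>\<^bsub>A\<^esub> y"
      using \<open>a \<in> _\<close> \<open>b \<in> _\<close> unfolding a_r_coset_def' by blast
    have c: "p \<in> carrier A" "q \<in> carrier A"
      using pq aug_pow_closed by blast+
    have "q \<in> ?I j"
      using pq aug_pow_Suc_subset by blast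
    then have "b \<in> ?I j"
      using pq y aug_pow_add_closed by simp
    then have "p \<otimes>\<^bsub>A\<^esub> b \<in> ?I (Suc (i + j))" "x \<otimes>\<^bsub>A\<^esub> q \<in> ?I (Suc (i + j))"
      using aug_pow_mult_closed[OF pq(1)] aug_pow_mult_closed[OF x pq(2)] by simp_all
    moreover have "(a \<otimes>\<^bsub>A\<^esub> b) \<ominus>\<^bsub>A\<^esub> (x \<otimes>\<^bsub>A\<^esub> y) = p \<otimes>\<^bsub>A\<^esub> b \<oplus>\<^bsub>A\<^esub> x \<otimes>\<^bsub>A\<^esub> q"
      unfolding pq(3,4) using xy c by algebra
    ultimately have "(a \<otimes>\<^bsub>A\<^esub> b) \<ominus>\<^bsub>A\<^esub> (x \<otimes>\<^bsub>A\<^esub> y) \<in> ?I (Suc (i + j))"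
      using aug_pow_add_closed by simp
    then show ?thesis
      using coset_eq_iff[OF ideal_aug_pow] xy c pq by simp
  qed
  have "x \<in> ?I (Suc i) +>\<^bsub>A\<^esub> x" "y \<in> ?I (Suc j) +>\<^bsub>A\<^esub> y"
    using xy abelian_subgroup.a_rcos_self[OF abelian_subgroupI3[OF ideal.axioms(1)[OF ideal_aug_pow]
        abelian_group_axioms]] by blast+
  then show ?thesis
    unfolding rcoset_mult_def using 1 by blast
qed

text \<open>Representatives of a class modulo \<open>I\<close> differ by an element of the kernel of
  the augmentation. This gives \<open>the_elem\<close> in the augmentation of the completion its
  value.\<close>

lemma aug_coset:
  assumes "x \<in> carrier A"
  shows "aug A ` (aug_pow K A (Suc 0) +>\<^bsub>A\<^esub> x) = {aug A x}"
proof -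
  interpret h: ring_hom_ring A K "aug A"
    by (rule aug_ring_hom_ring)
  have "aug A y = aug A x" if "y \<in> aug_pow K A (Suc 0) +>\<^bsub>A\<^esub> x" for y
  proof -
    obtain p where "p \<in> aug_ideal K A" "y = p \<oplus>\<^bsub>A\<^esub> x"
      using \<open>y \<in> _\<close> unfolding aug_pow_1 a_r_coset_def' by blast
    then show ?thesis
      using assms by (simp add: mem_aug_ideal_iff)
  qed
  moreover have "x \<in> aug_pow K A (Suc 0) +>\<^bsub>A\<^esub> x"
    using assms abelian_subgroup.a_rcos_self[OF abelian_subgroupI3[OF ideal.axioms(1)[OF
        ideal_aug_pow] abelian_group_axioms]] by blast
  ultimately show ?thesis
    by blast
qed

end

section \<open>Transport of finite generation along module isomorphisms\<close>

lemma fin_gen_module_iso: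
  assumes "module K M" "module K N" "bij_betw h (carrier M) (carrier N)"
    and add: "\<And>x y. x \<in> carrier M \<Longrightarrow> y \<in> carrier M \<Longrightarrow> h (x \<oplus>\<^bsub>M\<^esub> y) = h x \<oplus>\<^bsub>N\<^esub> h y"
    and zero: "h \<zero>\<^bsub>M\<^esub> = \<zero>\<^bsub>N\<^esub>"
    and smult: "\<And>c x. c \<in> carrier K \<Longrightarrow> x \<in> carrier M \<Longrightarrow> h (c \<odot>\<^bsub>M\<^esub> x) = c \<odot>\<^bsub>N\<^esub> h x"
    and "fin_gen_module K M"
  shows "fin_gen_module K N"
proof -
  interpret M: module K M by fact
  interpret N: module K N by fact
  obtain S where S: "finite S" "S \<subseteq> carrier M"
    and gen: "\<And>x. x \<in> carrier M \<Longrightarrow> \<exists>c. c \<in> S \<rightarrow> carrier K \<and> x = (\<Oplus>\<^bsub>M\<^esub>s\<in>S. c s \<odot>\<^bsub>M\<^esub> s)"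
    using assms(7) unfolding fin_gen_module_def by blast
  have inj: "inj_on h S"
    using assms(3) S by (auto simp: bij_betw_def intro: inj_on_subset)
  have hc: "h x \<in> carrier N" if "x \<in> carrier M" for x
    using assms(3) that by (auto simp: bij_betw_def)
  have "\<exists>d. d \<in> h ` S \<rightarrow> carrier K \<and> y = (\<Oplus>\<^bsub>N\<^esub>s\<in>h ` S. d s \<odot>\<^bsub>N\<^esub> s)"
    if y: "y \<in> carrier N" for y
  proof -
    obtain x where x: "x \<in> carrier M" "y = h x"
      using y bij_betw_imp_surj_on[OF assms(3)] by blast
    obtain c where c: "c \<in> S \<rightarrow> carrier K" "x = (\<Oplus>\<^bsub>M\<^esub>s\<in>S. c s \<odot>\<^bsub>M\<^esub> s)"
      using gen[OF x(1)] by blast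
    \<comment> \<open>The sum has to be indexed by the image of \<open>S\<close>; injectivity of
      \<open>h\<close> on \<open>S\<close> lets the coefficients be carried over along the
      inverse.\<close>
    define d where "d = c \<circ> inv_into S h"
    have d: "d (h s) = c s" if "s \<in> S" for s
      using that inj by (simp add: d_def)
    have dK: "d \<in> h ` S \<rightarrow> carrier K"
      using c d by auto
    have "y = (\<Oplus>\<^bsub>N\<^esub>s\<in>S. h (c s \<odot>\<^bsub>M\<^esub> s))"
      unfolding x c using S c
      by (intro finsum_hom[OF M.abelian_monoid_axioms N.abelian_monoid_axioms])
        (auto simp: add zero hc Pi_iff subset_iff)
    also have "\<dots> = (\<Oplus>\<^bsub>N\<^esub>s\<in>S. d (h s) \<odot>\<^bsub>N\<^esub> h s)"
      using S c d hc by (intro N.finsum_cong') (auto simp: smult Pi_iff subset_iff)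
    also have "\<dots> = (\<Oplus>\<^bsub>N\<^esub>s\<in>h ` S. d s \<odot>\<^bsub>N\<^esub> s)"
      using S dK hc inj by (intro N.finsum_reindex[symmetric]) (auto simp: Pi_iff subset_iff)
    finally show ?thesis
      using dK by blast
  qed
  moreover have "finite (h ` S)" "h ` S \<subseteq> carrier N"
    using S hc by auto
  ultimately show ?thesis
    unfolding fin_gen_module_def by blast
qed

subsection \<open>Homomorphisms with strict and dense image\<close>

text \<open>Strictness yields injectivity, and density surjectivity, on quotients by powers. The
  isomorphisms of quotients and graded algebras and the transfer of finite type are derived from
  these two properties; the natural map to the completion is the instance in view.\<close>

locale strict_dense_hom = A: augmented_algebra K A + B: augmented_algebra K B
  for K :: "('k, 'r) ring_scheme" and A :: "('k, 'a, 'm) aug_alg_scheme"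
    and B :: "('k, 'b, 'n) aug_alg_scheme" +
  fixes h :: "'a \<Rightarrow> 'b"
  assumes alg_hom: "h \<in> alg_hom K A B"
    and strict: "x \<in> carrier A \<Longrightarrow> h x \<in> aug_pow K B n \<longleftrightarrow> x \<in> aug_pow K A n"
    and dense: "y \<in> carrier B \<Longrightarrow> \<exists>x\<in>carrier A. y \<ominus>\<^bsub>B\<^esub> h x \<in> aug_pow K B n"
begin

lemma ring_hom_h: "h \<in> ring_hom A B"
  and h_smult: "c \<in> carrier K \<Longrightarrow> x \<in> carrier A \<Longrightarrow> h (c \<odot>\<^bsub>A\<^esub> x) = c \<odot>\<^bsub>B\<^esub> h x"
  using alg_hom by (simp_all add: alg_hom_def)

sublocale h: ring_hom_ring A B h
  using ring_hom_h A.ring_axioms B.ring_axioms by (intro ring_hom_ringI2)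

lemma h_minus: "x \<in> carrier A \<Longrightarrow> y \<in> carrier A \<Longrightarrow> h (x \<ominus>\<^bsub>A\<^esub> y) = h x \<ominus>\<^bsub>B\<^esub> h y"
  by (simp add: a_minus_def)

text \<open>The denominator alone determines the induced map, so one \<open>pow_quot n\<close>
  serves \<open>A/I^n\<close> and its submodules \<open>I^k/I^n\<close> alike.\<close>

definition pow_quot :: "nat \<Rightarrow> 'a set \<Rightarrow> 'b set"
  where "pow_quot n = quot_map B (aug_pow K B n) h"

lemma pow_quot_coset:
  assumes "x \<in> carrier A"
  shows "pow_quot n (aug_pow K A n +>\<^bsub>A\<^esub> x) = aug_pow K B n +>\<^bsub>B\<^esub> h x"
proof -
  have "h ` aug_pow K A n \<subseteq> aug_pow K B n"
    using strict A.aug_pow_closed by blast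
  then show ?thesis
    unfolding pow_quot_def using assms ring_hom_h A.ring_axioms B.ring_axioms
    by (intro quot_map_coset A.ideal_aug_pow B.ideal_aug_pow)
qed

lemma pow_quot_zero: "pow_quot n (aug_pow K A n) = aug_pow K B n"
  using pow_quot_coset[of "\<zero>\<^bsub>A\<^esub>" n]
  by (simp add: A.a_rcos_zero A.ideal_aug_pow B.a_rcos_zero B.ideal_aug_pow
      A.aug_pow_zero_closed B.aug_pow_zero_closed)

text \<open>Strictness makes cosets with equal images equal. For surjectivity, \<open>y\<close> is
  approximated by \<open>h x\<close> up to the \<open>n\<close>-th power; since
  \<open>k <= n\<close>, the error also lies in the \<open>k\<close>-th power, so \<open>h x\<close>
  lies there together with \<open>y\<close>, and strictness puts \<open>x\<close> in
  \<open>I^k\<close>. The uses are \<open>k = 0\<close> for the quotients, \<open>n = k + 1\<close>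
  for the graded pieces, and \<open>k = 1\<close>, \<open>n = 2\<close> for finite type.\<close>

lemma bij_pow_quot:
  assumes "k \<le> n"
  shows "bij_betw (pow_quot n) (carrier (subquot A (aug_pow K A k) (aug_pow K A n)))
    (carrier (subquot B (aug_pow K B k) (aug_pow K B n)))"
proof (rule bij_betwI')
  fix X Y assume "X \<in> carrier (subquot A (aug_pow K A k) (aug_pow K A n))"
    "Y \<in> carrier (subquot A (aug_pow K A k) (aug_pow K A n))"
  then obtain x y where xy: "x \<in> carrier A" "X = aug_pow K A n +>\<^bsub>A\<^esub> x"
    "y \<in> carrier A" "Y = aug_pow K A n +>\<^bsub>A\<^esub> y"
    using A.aug_pow_closed by auto
  then show "pow_quot n X = pow_quot n Y \<longleftrightarrow> X = Y"
    by (simp add: pow_quot_coset A.coset_eq_iff[OF A.ideal_aug_pow]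
        B.coset_eq_iff[OF B.ideal_aug_pow] strict flip: h_minus)
next
  fix X assume "X \<in> carrier (subquot A (aug_pow K A k) (aug_pow K A n))"
  then show "pow_quot n X \<in> carrier (subquot B (aug_pow K B k) (aug_pow K B n))"
    using A.aug_pow_closed strict by (auto simp: pow_quot_coset)
next
  fix Y assume "Y \<in> carrier (subquot B (aug_pow K B k) (aug_pow K B n))"
  then obtain y where y: "y \<in> aug_pow K B k" "Y = aug_pow K B n +>\<^bsub>B\<^esub> y"
    by auto
  have yc: "y \<in> carrier B"
    using y B.aug_pow_closed by blast
  obtain x where x: "x \<in> carrier A" "y \<ominus>\<^bsub>B\<^esub> h x \<in> aug_pow K B n"
    using dense yc by blast
  then have "y \<ominus>\<^bsub>B\<^esub> h x \<in> aug_pow K B k"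
    using B.aug_pow_antimono[OF assms] by blast
  then have "x \<in> aug_pow K A k"
    using B.ideal_mem_minus_iff[OF B.ideal_aug_pow yc, of "h x"] y(1) strict[OF x(1)] x(1) by simp
  moreover have "Y = pow_quot n (aug_pow K A n +>\<^bsub>A\<^esub> x)"
    using x y yc by (simp add: pow_quot_coset B.coset_eq_iff[OF B.ideal_aug_pow])
  ultimately show "\<exists>X\<in>carrier (subquot A (aug_pow K A k) (aug_pow K A n)). Y = pow_quot n X"
    by auto
qed

lemma pow_quot_add:
  assumes "X \<in> carrier (subquot A (aug_pow K A k) (aug_pow K A n))"
    and "Y \<in> carrier (subquot A (aug_pow K A k) (aug_pow K A n))"
  shows "pow_quot n (X \<oplus>\<^bsub>subquot A (aug_pow K A k) (aug_pow K A n)\<^esub> Y) =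
    pow_quot n X \<oplus>\<^bsub>subquot B (aug_pow K B k) (aug_pow K B n)\<^esub> pow_quot n Y"
  using assms A.aug_pow_closed
  by (auto simp: A.subquot_add[OF A.ideal_aug_pow] B.subquot_add[OF B.ideal_aug_pow] pow_quot_coset)

lemma pow_quot_smult:
  assumes "c \<in> carrier K" "X \<in> carrier (subquot A (aug_pow K A k) (aug_pow K A n))"
  shows "pow_quot n (c \<odot>\<^bsub>subquot A (aug_pow K A k) (aug_pow K A n)\<^esub> X) =
    c \<odot>\<^bsub>subquot B (aug_pow K B k) (aug_pow K B n)\<^esub> pow_quot n X"
  using assms A.aug_pow_closed
  by (auto simp: A.subquot_smult[OF A.ideal_aug_pow] B.subquot_smult[OF B.ideal_aug_pow]
      pow_quot_coset h_smult)

theorem alg_quot_iso: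
  "quot_map B (aug_pow K B n) h \<in> alg_iso K (alg_quot A (aug_pow K A n)) (alg_quot B (aug_pow K B n))"
proof -
  \<comment> \<open>The zeroth power is the whole algebra, so the quotient algebra is the
    subquotient with \<open>k = 0\<close>.\<close>
  have *: "alg_quot A (aug_pow K A n) = subquot A (aug_pow K A 0) (aug_pow K A n)"
    "alg_quot B (aug_pow K B n) = subquot B (aug_pow K B 0) (aug_pow K B n)"
    by (simp_all add: alg_quot_def)
  have bij: "bij_betw (pow_quot n) (carrier (alg_quot A (aug_pow K A n)))
      (carrier (alg_quot B (aug_pow K B n)))"
    unfolding * by (rule bij_pow_quot) simp
  have "pow_quot n \<in> ring_hom (alg_quot A (aug_pow K A n)) (alg_quot B (aug_pow K B n))"
  proof (rule ring_hom_memI)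
    fix X Y
    assume "X \<in> carrier (alg_quot A (aug_pow K A n))" "Y \<in> carrier (alg_quot A (aug_pow K A n))"
    then show "pow_quot n (X \<otimes>\<^bsub>alg_quot A (aug_pow K A n)\<^esub> Y) =
        pow_quot n X \<otimes>\<^bsub>alg_quot B (aug_pow K B n)\<^esub> pow_quot n Y"
      by (auto simp: alg_quot_def A.subquot_mult[OF A.ideal_aug_pow]
          B.subquot_mult[OF B.ideal_aug_pow] pow_quot_coset)
  next
    fix X Y
    assume "X \<in> carrier (alg_quot A (aug_pow K A n))" "Y \<in> carrier (alg_quot A (aug_pow K A n))"
    then show "pow_quot n (X \<oplus>\<^bsub>alg_quot A (aug_pow K A n)\<^esub> Y) =
        pow_quot n X \<oplus>\<^bsub>alg_quot B (aug_pow K B n)\<^esub> pow_quot n Y"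
      unfolding * by (rule pow_quot_add)
  qed (use bij_betwE[OF bij] in \<open>auto simp: alg_quot_def pow_quot_coset\<close>)
  then show ?thesis
    using bij pow_quot_smult[of _ _ 0 n]
    unfolding alg_iso_def alg_hom_def pow_quot_def[symmetric] * by blast
qed

text \<open>This treats one summand of the graded product in degree \<open>n\<close>. The bound
  \<open>i <= n\<close> makes \<open>i + (n - i)\<close> equal to \<open>n\<close>, so that factors
  taken modulo the powers \<open>i + 1\<close> and \<open>n - i + 1\<close> have a product modulo
  the power \<open>n + 1\<close>.\<close>

lemma gr_piece_mult_mem:
  assumes "f \<in> carrier (gr_alg K A)" "g \<in> carrier (gr_alg K A)" "i \<le> n"
  shows "rcoset_mult A (aug_pow K A (Suc n)) (f i) (g (n - i)) \<in> carrier (gr_piece K A n)"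
    and "pow_quot (Suc n) (rcoset_mult A (aug_pow K A (Suc n)) (f i) (g (n - i))) =
      rcoset_mult B (aug_pow K B (Suc n)) (pow_quot (Suc i) (f i)) (pow_quot (Suc (n - i)) (g (n - i)))"
proof -
  have "f i \<in> carrier (gr_piece K A i)" "g (n - i) \<in> carrier (gr_piece K A (n - i))"
    using assms by (auto simp: gr_alg_def)
  then obtain x y where x: "x \<in> aug_pow K A i" "f i = aug_pow K A (Suc i) +>\<^bsub>A\<^esub> x"
    and y: "y \<in> aug_pow K A (n - i)" "g (n - i) = aug_pow K A (Suc (n - i)) +>\<^bsub>A\<^esub> y"
    unfolding gr_piece_def carrier_subquot by blast
  have eq: "rcoset_mult A (aug_pow K A (Suc n)) (f i) (g (n - i)) =
      aug_pow K A (Suc n) +>\<^bsub>A\<^esub> (x \<otimes>\<^bsub>A\<^esub> y)"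
    using A.rcoset_mult_aug_pow[OF x(1) y(1)] assms(3) x y by simp
  have xy: "x \<in> carrier A" "y \<in> carrier A" "h x \<in> aug_pow K B i" "h y \<in> aug_pow K B (n - i)"
    using x y strict A.aug_pow_closed by blast+
  show "rcoset_mult A (aug_pow K A (Suc n)) (f i) (g (n - i)) \<in> carrier (gr_piece K A n)"
    using A.aug_pow_mult_closed[OF x(1) y(1)] assms(3) unfolding eq gr_piece_def by simp
  show "pow_quot (Suc n) (rcoset_mult A (aug_pow K A (Suc n)) (f i) (g (n - i))) =
      rcoset_mult B (aug_pow K B (Suc n)) (pow_quot (Suc i) (f i)) (pow_quot (Suc (n - i)) (g (n - i)))"
    using B.rcoset_mult_aug_pow[OF xy(3,4)] assms(3) xy(1,2) unfolding eq unfolding x(2) y(2)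
    by (simp add: pow_quot_coset)
qed

text \<open>The map acts degree by degree through the bijections of graded pieces, and
  multiplicativity is checked summand by summand.\<close>

theorem gr_iso: "gr_map K B h \<in> alg_iso K (gr_alg K A) (gr_alg K B)"
proof -
  have map: "gr_map K B h f = (\<lambda>n. pow_quot (Suc n) (f n))" for f
    by (simp add: gr_map_def pow_quot_def)
  have bij: "bij_betw (pow_quot (Suc n)) (carrier (gr_piece K A n)) (carrier (gr_piece K B n))" for n
    unfolding gr_piece_def by (rule bij_pow_quot) simp
  have zero: "pow_quot (Suc n) \<zero>\<^bsub>gr_piece K A n\<^esub> = \<zero>\<^bsub>gr_piece K B n\<^esub>" for n
    unfolding gr_piece_def zero_subquot by (rule pow_quot_zero)
  have modA: "module K (gr_piece K A n)" and modB: "module K (gr_piece K B n)" for n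
    unfolding gr_piece_def
    by (intro A.subquot_module B.subquot_module A.ideal_aug_pow B.ideal_aug_pow)+
  have zero_mem: "\<zero>\<^bsub>gr_piece K A n\<^esub> \<in> carrier (gr_piece K A n)" for n
    using modA by (intro abelian_monoid.zero_closed abelian_group.axioms(1) module.axioms(2))
  \<comment> \<open>A bijection of pieces that sends zero to zero neither creates nor destroys
    nonzero components. Hence supports agree, and finiteness of support passes in both
    directions.\<close>
  have nonzero: "pow_quot (Suc n) X \<noteq> \<zero>\<^bsub>gr_piece K B n\<^esub> \<longleftrightarrow> X \<noteq> \<zero>\<^bsub>gr_piece K A n\<^esub>"
    if "X \<in> carrier (gr_piece K A n)" for n X
    using bij[of n] that zero zero_mem by (metis bij_betw_def inj_onD)
  have supp: "{n. pow_quot (Suc n) (f n) \<noteq> \<zero>\<^bsub>gr_piece K B n\<^esub>} = {n. f n \<noteq> \<zero>\<^bsub>gr_piece K A n\<^esub>}"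
    if "\<And>n. f n \<in> carrier (gr_piece K A n)" for f
    using nonzero that by blast
  have carr: "f \<in> carrier (gr_alg K A) \<longleftrightarrow>
      (\<forall>n. f n \<in> carrier (gr_piece K A n)) \<and> finite {n. f n \<noteq> \<zero>\<^bsub>gr_piece K A n\<^esub>}" for f
    by (simp add: gr_alg_def)
  have carrB: "f \<in> carrier (gr_alg K B) \<longleftrightarrow>
      (\<forall>n. f n \<in> carrier (gr_piece K B n)) \<and> finite {n. f n \<noteq> \<zero>\<^bsub>gr_piece K B n\<^esub>}" for f
    by (simp add: gr_alg_def)
  have bij_gr: "bij_betw (gr_map K B h) (carrier (gr_alg K A)) (carrier (gr_alg K B))"
  proof (rule bij_betwI')
    fix f g assume "f \<in> carrier (gr_alg K A)" "g \<in> carrier (gr_alg K A)"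
    then have "pow_quot (Suc n) (f n) = pow_quot (Suc n) (g n) \<longleftrightarrow> f n = g n" for n
      using bij[of n] by (metis carr bij_betw_imp_inj_on inj_on_eq_iff)
    then show "gr_map K B h f = gr_map K B h g \<longleftrightarrow> f = g"
      by (auto simp: map fun_eq_iff)
  next
    fix f assume "f \<in> carrier (gr_alg K A)"
    then show "gr_map K B h f \<in> carrier (gr_alg K B)"
      using bij_betwE[OF bij] supp[of f] by (simp add: carr carrB map)
  next
    fix g assume g: "g \<in> carrier (gr_alg K B)"
    then have "g n \<in> carrier (gr_piece K B n)" for n
      by (simp add: carrB)
    \<comment> \<open>Preimages are chosen separately in each degree; the resulting family has the
      same support as \<open>g\<close>.\<close>
    then have "\<forall>n. \<exists>X\<in>carrier (gr_piece K A n). g n = pow_quot (Suc n) X"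
      using bij_betw_imp_surj_on[OF bij] by blast
    then obtain f where f: "\<And>n. f n \<in> carrier (gr_piece K A n)" "\<And>n. g n = pow_quot (Suc n) (f n)"
      by metis
    then have "f \<in> carrier (gr_alg K A)"
      using g supp[of f] by (simp add: carr carrB)
    then show "\<exists>f\<in>carrier (gr_alg K A). g = gr_map K B h f"
      using f(2) by (intro bexI[of _ f]) (auto simp: map)
  qed
  have "gr_map K B h \<in> ring_hom (gr_alg K A) (gr_alg K B)"
  proof (rule ring_hom_memI)
    fix f g assume f: "f \<in> carrier (gr_alg K A)" and g: "g \<in> carrier (gr_alg K A)"
    show "gr_map K B h (f \<otimes>\<^bsub>gr_alg K A\<^esub> g) = gr_map K B h f \<otimes>\<^bsub>gr_alg K B\<^esub> gr_map K B h g"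
    proof
      fix n
      let ?P = "\<lambda>i. rcoset_mult A (aug_pow K A (Suc n)) (f i) (g (n - i))"
      let ?Q = "\<lambda>i. rcoset_mult B (aug_pow K B (Suc n)) (pow_quot (Suc i) (f i))
        (pow_quot (Suc (n - i)) (g (n - i)))"
      interpret MA: module K "gr_piece K A n" by (rule modA)
      interpret MB: module K "gr_piece K B n" by (rule modB)
      have P: "?P i \<in> carrier (gr_piece K A n)" "pow_quot (Suc n) (?P i) = ?Q i" if "i \<in> {..n}" for i
        using gr_piece_mult_mem[OF f g, of i n] that by auto
      have Q: "?Q i \<in> carrier (gr_piece K B n)" if "i \<in> {..n}" for i
        using P[OF that] bij by (metis bij_betwE)
      \<comment> \<open>Additivity of the induced map moves it inside the convolution sum.\<close>
      have "pow_quot (Suc n) (\<Oplus>\<^bsub>gr_piece K A n\<^esub>i\<in>{..n}. ?P i)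
          = (\<Oplus>\<^bsub>gr_piece K B n\<^esub>i\<in>{..n}. pow_quot (Suc n) (?P i))"
        using P(1) bij_betwE[OF bij]
        by (intro finsum_hom MA.abelian_monoid_axioms MB.abelian_monoid_axioms zero)
          (auto simp: gr_piece_def pow_quot_add simp del: carrier_subquot)
      also have "\<dots> = (\<Oplus>\<^bsub>gr_piece K B n\<^esub>i\<in>{..n}. ?Q i)"
        using P(2) Q by (intro MB.finsum_cong') auto
      finally show "gr_map K B h (f \<otimes>\<^bsub>gr_alg K A\<^esub> g) n =
          (gr_map K B h f \<otimes>\<^bsub>gr_alg K B\<^esub> gr_map K B h g) n"
        by (simp add: map gr_alg_def)
    qed
    show "gr_map K B h (f \<oplus>\<^bsub>gr_alg K A\<^esub> g) = gr_map K B h f \<oplus>\<^bsub>gr_alg K B\<^esub> gr_map K B h g"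
      using f g unfolding map
      by (auto simp: gr_alg_def gr_piece_def pow_quot_add simp del: carrier_subquot)
  next
    \<comment> \<open>In degree zero the unit is the class of one modulo the first power; in all
      other degrees zero goes to zero.\<close>
    show "gr_map K B h \<one>\<^bsub>gr_alg K A\<^esub> = \<one>\<^bsub>gr_alg K B\<^esub>"
      using pow_quot_coset[of "\<one>\<^bsub>A\<^esub>" "Suc 0"] zero
      by (auto simp: gr_alg_def map fun_eq_iff)
  qed (use bij_betwE[OF bij_gr] in blast)
  moreover have "gr_map K B h (c \<odot>\<^bsub>gr_alg K A\<^esub> f) = c \<odot>\<^bsub>gr_alg K B\<^esub> gr_map K B h f"
    if "c \<in> carrier K" "f \<in> carrier (gr_alg K A)" for c f
    using that unfolding map
    by (auto simp: gr_alg_def gr_piece_def pow_quot_smult simp del: carrier_subquot)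
  ultimately show ?thesis
    using bij_gr by (simp add: alg_iso_def alg_hom_def)
qed

theorem finite_type_transfer:
  assumes "finite_type K A"
  shows "finite_type K B"
proof -
  \<comment> \<open>The augmentation ideal is rewritten as the first power, which makes
    \<open>I/I^2\<close> a subquotient of powers.\<close>
  have "fin_gen_module K (subquot A (aug_pow K A 1) (aug_pow K A 2))"
    using assms A.aug_pow_1 by (simp add: finite_type_def)
  moreover have "bij_betw (pow_quot 2) (carrier (subquot A (aug_pow K A 1) (aug_pow K A 2)))
    (carrier (subquot B (aug_pow K B 1) (aug_pow K B 2)))"
    by (rule bij_pow_quot) simp
  ultimately have "fin_gen_module K (subquot B (aug_pow K B 1) (aug_pow K B 2))"
    by (intro fin_gen_module_iso[where h = "pow_quot 2"
          and M = "subquot A (aug_pow K A 1) (aug_pow K A 2)"] A.subquot_module B.subquot_module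
        A.ideal_aug_pow B.ideal_aug_pow)
      (auto simp: pow_quot_add pow_quot_smult pow_quot_zero simp del: carrier_subquot)
  then show ?thesis
    using B.aug_pow_1 B.augmented_algebra_axioms by (simp add: finite_type_def)
qed

end

subsection \<open>The completion as Cauchy sequences\<close>

lemma completion_simps [simp]:
  shows "\<zero>\<^bsub>completion K A\<^esub> = (\<lambda>n. aug_pow K A n)"
    and "\<one>\<^bsub>completion K A\<^esub> = (\<lambda>n. aug_pow K A n +>\<^bsub>A\<^esub> \<one>\<^bsub>A\<^esub>)"
    and "f \<oplus>\<^bsub>completion K A\<^esub> g = (\<lambda>n. f n \<oplus>\<^bsub>alg_quot A (aug_pow K A n)\<^esub> g n)"
    and "f \<otimes>\<^bsub>completion K A\<^esub> g = (\<lambda>n. f n \<otimes>\<^bsub>alg_quot A (aug_pow K A n)\<^esub> g n)"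
    and "c \<odot>\<^bsub>completion K A\<^esub> f = (\<lambda>n. c \<odot>\<^bsub>alg_quot A (aug_pow K A n)\<^esub> f n)"
  by (simp_all add: completion_def alg_quot_def)

context augmented_algebra
begin

text \<open>These are the choices of representatives for compatible families of cosets. The rate of
  convergence is fixed so that the term \<open>a n\<close> already determines the limit modulo
  \<open>I^n\<close>.\<close>

definition cauchy :: "(nat \<Rightarrow> 'a) \<Rightarrow> bool"
  where "cauchy a \<longleftrightarrow> (\<forall>n. a n \<in> carrier A) \<and> (\<forall>n. a (Suc n) \<ominus>\<^bsub>A\<^esub> a n \<in> aug_pow K A n)"

definition seq_class :: "(nat \<Rightarrow> 'a) \<Rightarrow> nat \<Rightarrow> 'a set"
  where "seq_class a = (\<lambda>n. aug_pow K A n +>\<^bsub>A\<^esub> a n)"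

lemma cauchy_closed: "cauchy a \<Longrightarrow> a n \<in> carrier A"
  by (simp add: cauchy_def)

lemma cauchy_diff:
  assumes "cauchy a" "m \<le> n"
  shows "a n \<ominus>\<^bsub>A\<^esub> a m \<in> aug_pow K A m"
  using assms(2)
proof (induction n rule: dec_induct)
  case base
  then show ?case
    using assms(1) aug_pow_zero_closed by (simp add: cauchy_closed a_minus_def r_neg)
next
  case (step n)
  have c: "a (Suc n) \<in> carrier A" "a n \<in> carrier A" "a m \<in> carrier A"
    using assms(1) cauchy_closed by auto
  have "a (Suc n) \<ominus>\<^bsub>A\<^esub> a n \<in> aug_pow K A m"
    using assms(1) aug_pow_antimono[OF step.hyps(1)] by (auto simp: cauchy_def)
  moreover have "a (Suc n) \<ominus>\<^bsub>A\<^esub> a m = (a (Suc n) \<ominus>\<^bsub>A\<^esub> a n) \<oplus>\<^bsub>A\<^esub> (a n \<ominus>\<^bsub>A\<^esub> a m)"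
    using c by algebra
  ultimately show ?case
    using step.IH aug_pow_add_closed by simp
qed

text \<open>All terms from index \<open>m\<close> on agree modulo \<open>I^m\<close>, so membership
  of the limit in \<open>J_m\<close> can be tested at any later index.\<close>

lemma cauchy_mem_iff:
  assumes "cauchy a" "m \<le> n"
  shows "a n \<in> aug_pow K A m \<longleftrightarrow> a m \<in> aug_pow K A m"
  using ideal_mem_minus_iff[OF ideal_aug_pow _ _ cauchy_diff[OF assms]] assms(1) cauchy_closed
  by blast

lemma seq_class_eq_iff:
  assumes "cauchy a" "cauchy b"
  shows "seq_class a n = seq_class b n \<longleftrightarrow> a n \<ominus>\<^bsub>A\<^esub> b n \<in> aug_pow K A n"
  using assms by (simp add: seq_class_def cauchy_closed coset_eq_iff[OF ideal_aug_pow])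

lemma seq_class_zero_iff:
  assumes "cauchy a"
  shows "seq_class a n = aug_pow K A n \<longleftrightarrow> a n \<in> aug_pow K A n"
  using assms by (simp add: seq_class_def cauchy_closed coset_eq_ideal_iff[OF ideal_aug_pow])

lemma quot_map_id:
  assumes "x \<in> carrier A"
  shows "quot_map A (aug_pow K A n) (\<lambda>x. x) (aug_pow K A (Suc n) +>\<^bsub>A\<^esub> x) = aug_pow K A n +>\<^bsub>A\<^esub> x"
  using assms aug_pow_Suc_subset
  by (intro quot_map_coset[of A A]) (auto simp: ring_axioms ideal_aug_pow ring_hom_def)

text \<open>Representatives are chosen coset by coset, and compatibility with the projections
  becomes the Cauchy condition. This allows calculations in the completion to be made with sequences
  in \<open>A\<close>.\<close>

lemma completion_rep:
  "f \<in> carrier (completion K A) \<longleftrightarrow> (\<exists>a. cauchy a \<and> f = seq_class a)"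
proof
  assume f: "f \<in> carrier (completion K A)"
  then have "\<forall>n. \<exists>x\<in>carrier A. f n = aug_pow K A n +>\<^bsub>A\<^esub> x"
    unfolding completion_def alg_quot_def carrier_subquot image_iff by simp
  then obtain a where a: "\<And>n. a n \<in> carrier A" "\<And>n. f n = aug_pow K A n +>\<^bsub>A\<^esub> a n"
    by metis
  have "aug_pow K A n +>\<^bsub>A\<^esub> a (Suc n) = aug_pow K A n +>\<^bsub>A\<^esub> a n" for n
  proof -
    have "quot_map A (aug_pow K A n) (\<lambda>x. x) (f (Suc n)) = f n"
      using f by (simp add: completion_def)
    then show ?thesis
      unfolding a(2) using quot_map_id[OF a(1)] by simp
  qed
  then have "cauchy a"
    using a(1) by (simp add: cauchy_def coset_eq_iff[OF ideal_aug_pow])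
  moreover have "f = seq_class a"
    using a(2) by (simp add: seq_class_def fun_eq_iff)
  ultimately show "\<exists>a. cauchy a \<and> f = seq_class a"
    by blast
next
  assume "\<exists>a. cauchy a \<and> f = seq_class a"
  then obtain a where a: "cauchy a" "f = seq_class a"
    by blast
  then have "aug_pow K A n +>\<^bsub>A\<^esub> a (Suc n) = aug_pow K A n +>\<^bsub>A\<^esub> a n" for n
    by (simp add: cauchy_def coset_eq_iff[OF ideal_aug_pow])
  then show "f \<in> carrier (completion K A)"
    using a by (auto simp: completion_def alg_quot_def seq_class_def cauchy_closed quot_map_id)
qed

lemma seq_class_closed: "cauchy a \<Longrightarrow> seq_class a \<in> carrier (completion K A)"
  using completion_rep by blast

lemma seq_class_add:
  assumes "cauchy a" "cauchy b"
  shows "seq_class a \<oplus>\<^bsub>completion K A\<^esub> seq_class b = seq_class (\<lambda>n. a n \<oplus>\<^bsub>A\<^esub> b n)"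
  using assms by (simp add: seq_class_def alg_quot_def subquot_add[OF ideal_aug_pow] cauchy_closed)

lemma seq_class_mult:
  assumes "cauchy a" "cauchy b"
  shows "seq_class a \<otimes>\<^bsub>completion K A\<^esub> seq_class b = seq_class (\<lambda>n. a n \<otimes>\<^bsub>A\<^esub> b n)"
  using assms by (simp add: seq_class_def alg_quot_def subquot_mult[OF ideal_aug_pow] cauchy_closed)

lemma seq_class_smult:
  assumes "c \<in> carrier K" "cauchy a"
  shows "c \<odot>\<^bsub>completion K A\<^esub> seq_class a = seq_class (\<lambda>n. c \<odot>\<^bsub>A\<^esub> a n)"
  using assms by (simp add: seq_class_def alg_quot_def subquot_smult[OF ideal_aug_pow] cauchy_closed)

lemma cauchy_const: "x \<in> carrier A \<Longrightarrow> cauchy (\<lambda>_. x)"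
  using aug_pow_zero_closed by (simp add: cauchy_def a_minus_def r_neg)

lemma cauchy_add:
  assumes "cauchy a" "cauchy b"
  shows "cauchy (\<lambda>n. a n \<oplus>\<^bsub>A\<^esub> b n)"
proof -
  have "(a (Suc n) \<oplus>\<^bsub>A\<^esub> b (Suc n)) \<ominus>\<^bsub>A\<^esub> (a n \<oplus>\<^bsub>A\<^esub> b n) =
      (a (Suc n) \<ominus>\<^bsub>A\<^esub> a n) \<oplus>\<^bsub>A\<^esub> (b (Suc n) \<ominus>\<^bsub>A\<^esub> b n)" for n
    using cauchy_closed[OF assms(1), of n] cauchy_closed[OF assms(1), of "Suc n"]
      cauchy_closed[OF assms(2), of n] cauchy_closed[OF assms(2), of "Suc n"] by algebra
  then show ?thesis
    using assms aug_pow_add_closed by (simp add: cauchy_def)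
qed

lemma cauchy_mult:
  assumes "cauchy a" "cauchy b"
  shows "cauchy (\<lambda>n. a n \<otimes>\<^bsub>A\<^esub> b n)"
proof -
  have "(a (Suc n) \<otimes>\<^bsub>A\<^esub> b (Suc n)) \<ominus>\<^bsub>A\<^esub> (a n \<otimes>\<^bsub>A\<^esub> b n) =
      (a (Suc n) \<ominus>\<^bsub>A\<^esub> a n) \<otimes>\<^bsub>A\<^esub> b (Suc n) \<oplus>\<^bsub>A\<^esub> a n \<otimes>\<^bsub>A\<^esub> (b (Suc n) \<ominus>\<^bsub>A\<^esub> b n)" for n
    using cauchy_closed[OF assms(1), of n] cauchy_closed[OF assms(1), of "Suc n"]
      cauchy_closed[OF assms(2), of n] cauchy_closed[OF assms(2), of "Suc n"] by algebra
  then show ?thesis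
    using assms aug_pow_add_closed ideal.I_r_closed[OF ideal_aug_pow]
      ideal.I_l_closed[OF ideal_aug_pow] by (simp add: cauchy_def)
qed

lemma cauchy_smult:
  assumes "c \<in> carrier K" "cauchy a"
  shows "cauchy (\<lambda>n. c \<odot>\<^bsub>A\<^esub> a n)"
  using assms by (simp add: cauchy_def aug_pow_smult_closed flip: smult_minus)

lemma cauchy_inv:
  assumes "cauchy a"
  shows "cauchy (\<lambda>n. \<ominus>\<^bsub>A\<^esub> a n)"
proof -
  have "(\<ominus>\<^bsub>A\<^esub> a (Suc n)) \<ominus>\<^bsub>A\<^esub> (\<ominus>\<^bsub>A\<^esub> a n) = \<ominus>\<^bsub>A\<^esub> (a (Suc n) \<ominus>\<^bsub>A\<^esub> a n)" for n
    using cauchy_closed[OF assms, of n] cauchy_closed[OF assms, of "Suc n"] by algebra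
  then show ?thesis
    using assms aug_pow_inv_closed by (simp add: cauchy_def)
qed

lemma completion_map_eq: "completion_map K A x = seq_class (\<lambda>_. x)"
  by (simp add: completion_map_def seq_class_def)

lemma completion_zero: "\<zero>\<^bsub>completion K A\<^esub> = seq_class (\<lambda>_. \<zero>\<^bsub>A\<^esub>)"
  by (simp add: seq_class_def a_rcos_zero ideal_aug_pow aug_pow_zero_closed)

lemma completion_one: "\<one>\<^bsub>completion K A\<^esub> = seq_class (\<lambda>_. \<one>\<^bsub>A\<^esub>)"
  by (simp add: seq_class_def)

text \<open>The algebra laws hold at every index in the quotient \<open>A/I^n\<close>. Closure under
  the operations involves compatibility between indices and comes from representing
  sequences.\<close>

lemma completion_assoc_algebra: "assoc_algebra K (completion K A)"
proof -
  let ?C = "completion K A"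
  interpret Q: assoc_algebra K "alg_quot A (aug_pow K A n)" for n
    by (rule alg_quot_assoc_algebra[OF ideal_aug_pow])
  have pt: "f n \<in> carrier (alg_quot A (aug_pow K A n))" if "f \<in> carrier ?C" for f n
    using that by (simp add: completion_def)
  have zero: "aug_pow K A n \<oplus>\<^bsub>alg_quot A (aug_pow K A n)\<^esub> X = X"
    if "X \<in> carrier (alg_quot A (aug_pow K A n))" for n X
    using Q.l_zero[OF that] by (simp add: alg_quot_def)
  have one: "(aug_pow K A n +>\<^bsub>A\<^esub> \<one>\<^bsub>A\<^esub>) \<otimes>\<^bsub>alg_quot A (aug_pow K A n)\<^esub> X = X"
    "X \<otimes>\<^bsub>alg_quot A (aug_pow K A n)\<^esub> (aug_pow K A n +>\<^bsub>A\<^esub> \<one>\<^bsub>A\<^esub>) = X"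
    if "X \<in> carrier (alg_quot A (aug_pow K A n))" for n X
    using Q.l_one[OF that] Q.r_one[OF that] by (simp_all add: alg_quot_def)
  have add_closed: "f \<oplus>\<^bsub>?C\<^esub> g \<in> carrier ?C" if "f \<in> carrier ?C" "g \<in> carrier ?C" for f g
    using that cauchy_add seq_class_add unfolding completion_rep by blast
  have mult_closed: "f \<otimes>\<^bsub>?C\<^esub> g \<in> carrier ?C" if "f \<in> carrier ?C" "g \<in> carrier ?C" for f g
    using that cauchy_mult seq_class_mult unfolding completion_rep by blast
  have smult_closed: "c \<odot>\<^bsub>?C\<^esub> g \<in> carrier ?C" if "c \<in> carrier K" "g \<in> carrier ?C" for c g
    using that cauchy_smult seq_class_smult unfolding completion_rep by blast
  have zero_closed: "\<zero>\<^bsub>?C\<^esub> \<in> carrier ?C"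
    unfolding completion_zero by (intro seq_class_closed cauchy_const) simp
  have one_closed: "\<one>\<^bsub>?C\<^esub> \<in> carrier ?C"
    unfolding completion_one by (intro seq_class_closed cauchy_const) simp
  have ab: "abelian_group ?C"
  proof (rule abelian_groupI)
    fix f assume "f \<in> carrier ?C"
    then obtain a where a: "cauchy a" "f = seq_class a"
      by (auto simp: completion_rep)
    have "seq_class (\<lambda>n. \<ominus>\<^bsub>A\<^esub> a n) \<oplus>\<^bsub>?C\<^esub> f = seq_class (\<lambda>n. \<ominus>\<^bsub>A\<^esub> a n \<oplus>\<^bsub>A\<^esub> a n)"
      using a by (simp add: seq_class_add cauchy_inv del: completion_simps)
    also have "\<dots> = \<zero>\<^bsub>?C\<^esub>"
      using a by (simp add: completion_zero cauchy_closed l_neg del: completion_simps)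
    finally show "\<exists>g\<in>carrier ?C. g \<oplus>\<^bsub>?C\<^esub> f = \<zero>\<^bsub>?C\<^esub>"
      using a cauchy_inv seq_class_closed by blast
    show "\<zero>\<^bsub>?C\<^esub> \<oplus>\<^bsub>?C\<^esub> f = f"
      using pt[OF \<open>f \<in> carrier ?C\<close>] by (simp add: zero)
  next
    fix f g assume "f \<in> carrier ?C" "g \<in> carrier ?C"
    then show "f \<oplus>\<^bsub>?C\<^esub> g = g \<oplus>\<^bsub>?C\<^esub> f"
      using pt by (simp add: Q.a_comm)
  next
    fix f g h assume "f \<in> carrier ?C" "g \<in> carrier ?C" "h \<in> carrier ?C"
    then show "f \<oplus>\<^bsub>?C\<^esub> g \<oplus>\<^bsub>?C\<^esub> h = f \<oplus>\<^bsub>?C\<^esub> (g \<oplus>\<^bsub>?C\<^esub> h)"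
      using pt by (simp add: Q.a_assoc)
  qed (use add_closed zero_closed in auto)
  have "ring ?C"
  proof (rule ringI)
    show "abelian_group ?C"
      by (rule ab)
    show "monoid ?C"
      using pt mult_closed one_closed by (intro monoidI) (auto simp: one Q.m_assoc)
  qed (use pt in \<open>auto simp: Q.l_distr Q.r_distr\<close>)
  moreover have "module K ?C"
    using pt smult_closed
    by (intro moduleI ab R.cring_axioms)
      (auto simp: Q.smult_l_distr Q.smult_r_distr Q.smult_assoc1)
  ultimately show ?thesis
    using pt by (intro assoc_algebra.intro assoc_algebra_axioms.intro)
      (auto simp: Q.smult_mult_left Q.smult_mult_right)
qed

lemma aug_seq_class: "cauchy a \<Longrightarrow> aug (completion K A) (seq_class a) = aug A (a (Suc 0))"
  by (simp add: completion_def seq_class_def aug_coset cauchy_closed)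

text \<open>The augmentation of a class is read off the term of index one, so its laws are those of
  \<open>aug A\<close>.\<close>

lemma augmented_completion: "augmented_algebra K (completion K A)"
proof -
  let ?C = "completion K A"
  have "aug ?C \<in> ring_hom ?C K"
  proof (rule ring_hom_memI)
    fix f g assume "f \<in> carrier ?C" "g \<in> carrier ?C"
    then obtain a b where ab: "cauchy a" "f = seq_class a" "cauchy b" "g = seq_class b"
      by (auto simp: completion_rep)
    then show "aug ?C f \<in> carrier K"
      "aug ?C (f \<otimes>\<^bsub>?C\<^esub> g) = aug ?C f \<otimes>\<^bsub>K\<^esub> aug ?C g"
      "aug ?C (f \<oplus>\<^bsub>?C\<^esub> g) = aug ?C f \<oplus>\<^bsub>K\<^esub> aug ?C g"
      using aug_ring_hom
      by (simp_all add: aug_seq_class seq_class_mult seq_class_add cauchy_mult cauchy_add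
          cauchy_closed ring_hom_closed ring_hom_mult ring_hom_add del: completion_simps)
  next
    show "aug ?C \<one>\<^bsub>?C\<^esub> = \<one>\<^bsub>K\<^esub>"
      unfolding completion_one using aug_ring_hom
      by (simp add: aug_seq_class cauchy_const ring_hom_one)
  qed
  moreover have "aug ?C (c \<odot>\<^bsub>?C\<^esub> f) = c \<otimes>\<^bsub>K\<^esub> aug ?C f" if c: "c \<in> carrier K" and "f \<in> carrier ?C" for c f
  proof -
    obtain a where "cauchy a" "f = seq_class a"
      using \<open>f \<in> carrier ?C\<close> by (auto simp: completion_rep)
    then show ?thesis
      using c by (simp add: aug_seq_class seq_class_smult cauchy_smult cauchy_closed aug_smult
          del: completion_simps)
  qed
  ultimately show ?thesis
    using completion_assoc_algebra by (intro augmented_algebra.intro augmented_algebra_axioms.intro)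
qed

lemma completion_map_alg_hom: "completion_map K A \<in> alg_hom K A (completion K A)"
  unfolding alg_hom_def completion_map_eq
  by (auto intro!: ring_hom_memI simp: seq_class_closed cauchy_const seq_class_mult seq_class_add
      seq_class_smult completion_one simp del: completion_simps)

lemma aug_completion_map:
  "x \<in> carrier A \<Longrightarrow> aug (completion K A) (completion_map K A x) = aug A x"
  unfolding completion_map_eq by (simp add: aug_seq_class cauchy_const)

lemma completion_inv:
  assumes "cauchy a"
  shows "\<ominus>\<^bsub>completion K A\<^esub> seq_class a = seq_class (\<lambda>n. \<ominus>\<^bsub>A\<^esub> a n)"
proof -
  interpret C: assoc_algebra K "completion K A"
    by (rule completion_assoc_algebra)
  have "seq_class (\<lambda>n. \<ominus>\<^bsub>A\<^esub> a n) \<oplus>\<^bsub>completion K A\<^esub> seq_class a = \<zero>\<^bsub>completion K A\<^esub>"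
    using assms by (simp add: seq_class_add cauchy_inv completion_zero cauchy_closed l_neg
        del: completion_simps)
  then show ?thesis
    using assms by (intro C.minus_equality seq_class_closed cauchy_inv)
qed

lemma seq_class_minus:
  assumes "cauchy a" "cauchy b"
  shows "seq_class a \<ominus>\<^bsub>completion K A\<^esub> seq_class b = seq_class (\<lambda>n. a n \<ominus>\<^bsub>A\<^esub> b n)"
  using assms by (simp add: a_minus_def completion_inv seq_class_add cauchy_inv del: completion_simps)

lemma cauchy_minus: "cauchy a \<Longrightarrow> cauchy b \<Longrightarrow> cauchy (\<lambda>n. a n \<ominus>\<^bsub>A\<^esub> b n)"
  unfolding a_minus_def by (intro cauchy_add cauchy_inv)

text \<open>The two conclusions are proved together because adding one more class requires the
  partial sum to be represented by a Cauchy sequence.\<close>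

lemma cauchy_finsum:
  assumes "finite T" "\<And>t. t \<in> T \<Longrightarrow> cauchy (d t)"
  shows "cauchy (\<lambda>n. \<Oplus>\<^bsub>A\<^esub>t\<in>T. d t n) \<and>
    (\<Oplus>\<^bsub>completion K A\<^esub>t\<in>T. seq_class (d t)) = seq_class (\<lambda>n. \<Oplus>\<^bsub>A\<^esub>t\<in>T. d t n)"
  using assms
proof (induction T rule: finite_induct)
  case empty
  interpret C: assoc_algebra K "completion K A"
    by (rule completion_assoc_algebra)
  show ?case
    by (simp add: cauchy_const completion_zero del: completion_simps)
next
  case (insert t T)
  interpret C: assoc_algebra K "completion K A"
    by (rule completion_assoc_algebra)
  have d: "(\<lambda>t. d t n) \<in> T \<rightarrow> carrier A" "d t n \<in> carrier A" for n
    using insert.prems cauchy_closed by auto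
  have eq: "(\<lambda>n. \<Oplus>\<^bsub>A\<^esub>t\<in>insert t T. d t n) = (\<lambda>n. d t n \<oplus>\<^bsub>A\<^esub> (\<Oplus>\<^bsub>A\<^esub>t\<in>T. d t n))"
    using insert.hyps d by simp
  have "(\<lambda>t. seq_class (d t)) \<in> T \<rightarrow> carrier (completion K A)"
    "seq_class (d t) \<in> carrier (completion K A)"
    using insert.prems seq_class_closed by auto
  then have "(\<Oplus>\<^bsub>completion K A\<^esub>t\<in>insert t T. seq_class (d t)) =
      seq_class (d t) \<oplus>\<^bsub>completion K A\<^esub> (\<Oplus>\<^bsub>completion K A\<^esub>t\<in>T. seq_class (d t))"
    using insert.hyps by (simp del: completion_simps)
  then show ?case
    unfolding eq using insert by (simp add: cauchy_add seq_class_add del: completion_simps)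
qed

subsection \<open>The powers of the augmentation ideal of the completion\<close>

text \<open>The augmentation reads the term of index one, and this term is in the kernel exactly
  when its class in \<open>A/I\<close> is zero. Thus the augmentation ideal is
  \<open>J_1\<close>.\<close>

lemma mem_aug_ideal_completion_iff:
  "f \<in> aug_ideal K (completion K A) \<longleftrightarrow>
    f \<in> carrier (completion K A) \<and> f (Suc 0) = aug_pow K A (Suc 0)"
proof -
  interpret C: augmented_algebra K "completion K A"
    by (rule augmented_completion)
  have "aug (completion K A) (seq_class a) = \<zero>\<^bsub>K\<^esub> \<longleftrightarrow> seq_class a (Suc 0) = aug_pow K A (Suc 0)"
    if "cauchy a" for a
    using that seq_class_zero_iff[of a "Suc 0"]
    by (simp add: aug_seq_class aug_pow_1 mem_aug_ideal_iff cauchy_closed)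
  then show ?thesis
    unfolding C.mem_aug_ideal_iff completion_rep by blast
qed

text \<open>The product of \<open>J_n\<close> and \<open>J_1\<close> lies in \<open>J_(n+1)\<close>,
  so the powers of the augmentation ideal \<open>J_1\<close> cannot leave the filtration. Membership
  in \<open>J_n\<close> is written as having the zero coset as component in
  \<open>A/I^n\<close>.\<close>

lemma aug_pow_completion_subset:
  "aug_pow K (completion K A) n \<subseteq> {f \<in> carrier (completion K A). f n = aug_pow K A n}"
proof (induction n)
  case 0
  \<comment> \<open>The component of index zero lives in the zero ring, so its condition is
    automatic.\<close>
  have "f 0 = carrier A" if "f \<in> carrier (completion K A)" for f
    using that unfolding completion_rep
    by (metis aug_pow.simps(1) cauchy_closed seq_class_zero_iff)
  then show ?case
    by auto
next
  case (Suc n)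
  let ?C = "completion K A"
  show ?case
  proof
    fix f assume "f \<in> aug_pow K ?C (Suc n)"
    then have "f \<in> aug_pow K ?C n \<cdot>\<^bsub>?C\<^esub> aug_ideal K ?C"
      by (simp add: aug_pow.simps(2))
    \<comment> \<open>In terms of representing sequences, the terms of index \<open>n + 1\<close>
      can be multiplied and added in \<open>A\<close>.\<close>
    then have "\<exists>a. cauchy a \<and> f = seq_class a \<and> a (Suc n) \<in> aug_pow K A (Suc n)"
    proof (induction f rule: ideal_prod.induct)
      case (prod f g)
      have "f \<in> carrier ?C" "f n = aug_pow K A n"
        "g \<in> carrier ?C" "g (Suc 0) = aug_pow K A (Suc 0)"
        using prod Suc.IH mem_aug_ideal_completion_iff by auto
      then obtain a b where ab: "cauchy a" "f = seq_class a" "a n \<in> aug_pow K A n"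
        "cauchy b" "g = seq_class b" "b (Suc 0) \<in> aug_pow K A (Suc 0)"
        using seq_class_zero_iff by (auto simp: completion_rep)
      \<comment> \<open>The factors are controlled at the indices \<open>n\<close> and one; both
        conditions are moved to the common index \<open>n + 1\<close>.\<close>
      then have "a (Suc n) \<in> aug_pow K A n" "b (Suc n) \<in> aug_pow K A (Suc 0)"
        using cauchy_mem_iff[of a n "Suc n"] cauchy_mem_iff[of b "Suc 0" "Suc n"] by auto
      then have "a (Suc n) \<otimes>\<^bsub>A\<^esub> b (Suc n) \<in> aug_pow K A (Suc n)"
        using aug_pow_mult_closed by fastforce
      then show ?case
        using ab cauchy_mult seq_class_mult by blast
    next
      case (sum f g)
      then obtain a b where ab: "cauchy a" "f = seq_class a" "a (Suc n) \<in> aug_pow K A (Suc n)"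
        "cauchy b" "g = seq_class b" "b (Suc n) \<in> aug_pow K A (Suc n)"
        by blast
      then show ?case
        using cauchy_add seq_class_add aug_pow_add_closed by blast
    qed
    then show "f \<in> {f \<in> carrier ?C. f (Suc n) = aug_pow K A (Suc n)}"
      using seq_class_zero_iff seq_class_closed by blast
  qed
qed

section \<open>Expansions in generators modulo the square\<close>

text \<open>Generation of \<open>I/I^2\<close> is expressed by congruences in \<open>A\<close>
  between lifts, so that they can be multiplied by elements of higher powers.\<close>

definition generates_aug_ideal :: "'t set \<Rightarrow> ('t \<Rightarrow> 'a) \<Rightarrow> bool"
  where "generates_aug_ideal T r \<longleftrightarrow> finite T \<and> r \<in> T \<rightarrow> aug_ideal K A \<and>
    (\<forall>x\<in>aug_ideal K A. \<exists>c\<in>T \<rightarrow> carrier K.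
      x \<ominus>\<^bsub>A\<^esub> (\<Oplus>\<^bsub>A\<^esub>t\<in>T. c t \<odot>\<^bsub>A\<^esub> r t) \<in> aug_pow K A (Suc (Suc 0)))"

text \<open>The index set is the set of generating cosets itself, and \<open>r\<close> picks a
  representative in \<open>I\<close> from each.\<close>

lemma finite_type_generators:
  assumes "finite_type K A"
  obtains T :: "'a set set" and r where "generates_aug_ideal T r"
proof -
  let ?I = "aug_ideal K A" and ?J = "aug_pow K A (Suc (Suc 0))"
  let ?Q = "subquot A ?I ?J"
  interpret Q: module K ?Q
    by (rule subquot_module[OF ideal_aug_ideal ideal_aug_pow])
  interpret I: ideal ?I A
    by (rule ideal_aug_ideal)
  have "fin_gen_module K ?Q"
    using assms unfolding finite_type_def numeral_2_eq_2 by (rule conjunct2)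
  then obtain T where T: "finite T" "T \<subseteq> carrier ?Q"
    and gen: "\<And>X. X \<in> carrier ?Q \<Longrightarrow>
      \<exists>c. c \<in> T \<rightarrow> carrier K \<and> X = (\<Oplus>\<^bsub>?Q\<^esub>t\<in>T. c t \<odot>\<^bsub>?Q\<^esub> t)"
    unfolding fin_gen_module_def
    by (elim exE conjE) (rule that, assumption, assumption, erule (1) bspec)
  have "\<forall>t\<in>T. \<exists>x\<in>?I. ?J +>\<^bsub>A\<^esub> x = t"
    using T(2) by auto
  then obtain r where r: "\<And>t. t \<in> T \<Longrightarrow> r t \<in> ?I" "\<And>t. t \<in> T \<Longrightarrow> ?J +>\<^bsub>A\<^esub> r t = t"
    by metis
  have "\<exists>c\<in>T \<rightarrow> carrier K. x \<ominus>\<^bsub>A\<^esub> (\<Oplus>\<^bsub>A\<^esub>t\<in>T. c t \<odot>\<^bsub>A\<^esub> r t) \<in> ?J" if x: "x \<in> ?I" for x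
  proof -
    obtain c where c: "c \<in> T \<rightarrow> carrier K" "?J +>\<^bsub>A\<^esub> x = (\<Oplus>\<^bsub>?Q\<^esub>t\<in>T. c t \<odot>\<^bsub>?Q\<^esub> t)"
      using gen[of "?J +>\<^bsub>A\<^esub> x"] x by auto
    have mem: "(\<lambda>t. c t \<odot>\<^bsub>A\<^esub> r t) \<in> T \<rightarrow> ?I"
      using c(1) r(1) ideal_smult_closed[OF ideal_aug_ideal] by (auto simp: Pi_iff)
    \<comment> \<open>The coset map is pushed through the sum with \<open>D\<close> equal to
      \<open>I\<close>.\<close>
    have "(\<Oplus>\<^bsub>A\<^esub>t\<in>T. c t \<odot>\<^bsub>A\<^esub> r t) \<in> ?I \<and>
        ?J +>\<^bsub>A\<^esub> (\<Oplus>\<^bsub>A\<^esub>t\<in>T. c t \<odot>\<^bsub>A\<^esub> r t) = (\<Oplus>\<^bsub>?Q\<^esub>t\<in>T. ?J +>\<^bsub>A\<^esub> (c t \<odot>\<^bsub>A\<^esub> r t))"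
      by (rule finsum_hom_on[where h = "\<lambda>x. ?J +>\<^bsub>A\<^esub> x", OF abelian_monoid_axioms Q.abelian_monoid_axioms])
        (use T mem in \<open>auto simp: subquot_add[OF ideal_aug_pow] a_rcos_zero ideal_aug_pow
          aug_pow_zero_closed I.a_closed\<close>)
    moreover have "(\<Oplus>\<^bsub>?Q\<^esub>t\<in>T. ?J +>\<^bsub>A\<^esub> (c t \<odot>\<^bsub>A\<^esub> r t)) = (\<Oplus>\<^bsub>?Q\<^esub>t\<in>T. c t \<odot>\<^bsub>?Q\<^esub> t)"
    proof (rule Q.finsum_cong')
      show "(\<lambda>t. c t \<odot>\<^bsub>?Q\<^esub> t) \<in> T \<rightarrow> carrier ?Q"
        using c(1) T(2) by (auto simp del: carrier_subquot)
      fix t assume t: "t \<in> T"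
      then have "c t \<in> carrier K"
        using c(1) by auto
      then show "?J +>\<^bsub>A\<^esub> (c t \<odot>\<^bsub>A\<^esub> r t) = c t \<odot>\<^bsub>?Q\<^esub> t"
        using r[OF t] subquot_smult[OF ideal_aug_pow, of "c t" "r t" ?I "Suc (Suc 0)"] by simp
    qed simp
    ultimately have "?J +>\<^bsub>A\<^esub> x = ?J +>\<^bsub>A\<^esub> (\<Oplus>\<^bsub>A\<^esub>t\<in>T. c t \<odot>\<^bsub>A\<^esub> r t)"
      "(\<Oplus>\<^bsub>A\<^esub>t\<in>T. c t \<odot>\<^bsub>A\<^esub> r t) \<in> ?I"
      using c(2) by simp_all
    then show ?thesis
      using c(1) x coset_eq_iff[OF ideal_aug_pow] by (auto simp: I.a_Hcarr)
  qed
  then have "generates_aug_ideal T r"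
    using T(1) r(1) by (simp add: generates_aug_ideal_def)
  then show ?thesis
    by (rule that)
qed

text \<open>Modulo the next power, the right factor of a product in \<open>I\<^sup>m \<cdot> I\<close> may be replaced by a linear
  combination of the generators, whose scalars move to the left factor.\<close>

lemma aug_pow_Suc_expansion:
  assumes gen: "generates_aug_ideal T r"
    and x: "x \<in> aug_pow K A (Suc m)"
  shows "\<exists>e\<in>T \<rightarrow> aug_pow K A m.
    x \<ominus>\<^bsub>A\<^esub> (\<Oplus>\<^bsub>A\<^esub>t\<in>T. e t \<otimes>\<^bsub>A\<^esub> r t) \<in> aug_pow K A (Suc (Suc m))"
proof -
  have "finite T"
    using gen by (simp add: generates_aug_ideal_def)
  have rc: "r t \<in> carrier A" if "t \<in> T" for t
    using gen that mem_aug_ideal_iff unfolding generates_aug_ideal_def by blast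
  have "x \<in> aug_pow K A m \<cdot>\<^bsub>A\<^esub> aug_ideal K A"
    using x by (simp add: aug_pow.simps(2))
  then show ?thesis
  proof (induction x rule: ideal_prod.induct)
    case (prod i j)
    obtain c where c: "c \<in> T \<rightarrow> carrier K"
      "j \<ominus>\<^bsub>A\<^esub> (\<Oplus>\<^bsub>A\<^esub>t\<in>T. c t \<odot>\<^bsub>A\<^esub> r t) \<in> aug_pow K A (Suc (Suc 0))"
      using gen prod(2) unfolding generates_aug_ideal_def by blast
    have i: "i \<in> carrier A" and j: "j \<in> carrier A"
      using prod aug_pow_closed mem_aug_ideal_iff by auto
    have cr: "(\<lambda>t. c t \<odot>\<^bsub>A\<^esub> r t) \<in> T \<rightarrow> carrier A"
      using c(1) rc by auto
    have "(\<Oplus>\<^bsub>A\<^esub>t\<in>T. (c t \<odot>\<^bsub>A\<^esub> i) \<otimes>\<^bsub>A\<^esub> r t) = (\<Oplus>\<^bsub>A\<^esub>t\<in>T. i \<otimes>\<^bsub>A\<^esub> (c t \<odot>\<^bsub>A\<^esub> r t))"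
      using c(1) i rc cr by (intro finsum_cong') (auto simp: smult_mult_left smult_mult_right Pi_iff)
    also have "\<dots> = i \<otimes>\<^bsub>A\<^esub> (\<Oplus>\<^bsub>A\<^esub>t\<in>T. c t \<odot>\<^bsub>A\<^esub> r t)"
      using \<open>finite T\<close> i cr by (simp add: finsum_rdistr)
    finally have "i \<otimes>\<^bsub>A\<^esub> j \<ominus>\<^bsub>A\<^esub> (\<Oplus>\<^bsub>A\<^esub>t\<in>T. (c t \<odot>\<^bsub>A\<^esub> i) \<otimes>\<^bsub>A\<^esub> r t) =
        i \<otimes>\<^bsub>A\<^esub> (j \<ominus>\<^bsub>A\<^esub> (\<Oplus>\<^bsub>A\<^esub>t\<in>T. c t \<odot>\<^bsub>A\<^esub> r t))"
      using i j finsum_closed[OF cr] by (simp add: a_minus_def r_distr r_minus)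
    \<comment> \<open>An element of \<open>I^m\<close> times one of \<open>I^2\<close> lies in
      \<open>I^(m+2)\<close>, one order beyond \<open>x\<close>.\<close>
    also have "\<dots> \<in> aug_pow K A (Suc (Suc m))"
      using aug_pow_mult_closed[OF prod(1) c(2)] by simp
    finally have "i \<otimes>\<^bsub>A\<^esub> j \<ominus>\<^bsub>A\<^esub> (\<Oplus>\<^bsub>A\<^esub>t\<in>T. (c t \<odot>\<^bsub>A\<^esub> i) \<otimes>\<^bsub>A\<^esub> r t) \<in> aug_pow K A (Suc (Suc m))" .
    moreover have "(\<lambda>t. c t \<odot>\<^bsub>A\<^esub> i) \<in> T \<rightarrow> aug_pow K A m"
      using c(1) prod(1) aug_pow_smult_closed by auto
    ultimately show ?case
      by (intro bexI[of _ "\<lambda>t. c t \<odot>\<^bsub>A\<^esub> i"])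
  next
    case (sum x y)
    obtain e f where e: "e \<in> T \<rightarrow> aug_pow K A m"
      "x \<ominus>\<^bsub>A\<^esub> (\<Oplus>\<^bsub>A\<^esub>t\<in>T. e t \<otimes>\<^bsub>A\<^esub> r t) \<in> aug_pow K A (Suc (Suc m))"
      and f: "f \<in> T \<rightarrow> aug_pow K A m"
      "y \<ominus>\<^bsub>A\<^esub> (\<Oplus>\<^bsub>A\<^esub>t\<in>T. f t \<otimes>\<^bsub>A\<^esub> r t) \<in> aug_pow K A (Suc (Suc m))"
      using sum.IH by blast
    have xy: "x \<in> carrier A" "y \<in> carrier A"
      using sum.hyps aug_pow_closed[of _ "Suc m"] by (auto simp: aug_pow.simps(2))
    have ef: "e t \<in> carrier A" "f t \<in> carrier A" if "t \<in> T" for t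
      using e f that aug_pow_closed by blast+
    have er: "(\<lambda>t. e t \<otimes>\<^bsub>A\<^esub> r t) \<in> T \<rightarrow> carrier A" "(\<lambda>t. f t \<otimes>\<^bsub>A\<^esub> r t) \<in> T \<rightarrow> carrier A"
      using ef rc by auto
    have "(\<Oplus>\<^bsub>A\<^esub>t\<in>T. (e t \<oplus>\<^bsub>A\<^esub> f t) \<otimes>\<^bsub>A\<^esub> r t) =
        (\<Oplus>\<^bsub>A\<^esub>t\<in>T. e t \<otimes>\<^bsub>A\<^esub> r t \<oplus>\<^bsub>A\<^esub> f t \<otimes>\<^bsub>A\<^esub> r t)"
      using ef rc er by (intro finsum_cong') (auto simp: l_distr Pi_iff)
    also have "\<dots> = (\<Oplus>\<^bsub>A\<^esub>t\<in>T. e t \<otimes>\<^bsub>A\<^esub> r t) \<oplus>\<^bsub>A\<^esub> (\<Oplus>\<^bsub>A\<^esub>t\<in>T. f t \<otimes>\<^bsub>A\<^esub> r t)"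
      using er by (rule finsum_addf)
    finally have "x \<oplus>\<^bsub>A\<^esub> y \<ominus>\<^bsub>A\<^esub> (\<Oplus>\<^bsub>A\<^esub>t\<in>T. (e t \<oplus>\<^bsub>A\<^esub> f t) \<otimes>\<^bsub>A\<^esub> r t) =
        (x \<ominus>\<^bsub>A\<^esub> (\<Oplus>\<^bsub>A\<^esub>t\<in>T. e t \<otimes>\<^bsub>A\<^esub> r t)) \<oplus>\<^bsub>A\<^esub> (y \<ominus>\<^bsub>A\<^esub> (\<Oplus>\<^bsub>A\<^esub>t\<in>T. f t \<otimes>\<^bsub>A\<^esub> r t))"
      using xy finsum_closed[OF er(1)] finsum_closed[OF er(2)]
      by (simp add: a_minus_def minus_add a_ac)
    then have "x \<oplus>\<^bsub>A\<^esub> y \<ominus>\<^bsub>A\<^esub> (\<Oplus>\<^bsub>A\<^esub>t\<in>T. (e t \<oplus>\<^bsub>A\<^esub> f t) \<otimes>\<^bsub>A\<^esub> r t) \<in> aug_pow K A (Suc (Suc m))"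
      using aug_pow_add_closed[OF e(2) f(2)] by simp
    moreover have "(\<lambda>t. e t \<oplus>\<^bsub>A\<^esub> f t) \<in> T \<rightarrow> aug_pow K A m"
      using e f aug_pow_add_closed by blast
    ultimately show ?case
      by (intro bexI[of _ "\<lambda>t. e t \<oplus>\<^bsub>A\<^esub> f t"])
  qed
qed

text \<open>Successive approximation: \<open>u k\<close> are the coefficients of an expansion of the \<open>n + k + 1\<close>-st term,
  and passing from \<open>u k\<close> to \<open>u (k + 1)\<close> expands the remainder.\<close>

lemma cauchy_expansion:
  assumes gen: "generates_aug_ideal T r"
    and a: "cauchy a" "a (Suc n) \<in> aug_pow K A (Suc n)"
  shows "\<exists>u. \<forall>k. (u k \<in> T \<rightarrow> aug_pow K A n \<and>
      a (Suc (n + k)) \<ominus>\<^bsub>A\<^esub> (\<Oplus>\<^bsub>A\<^esub>t\<in>T. u k t \<otimes>\<^bsub>A\<^esub> r t) \<in> aug_pow K A (Suc (n + k))) \<and>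
      (\<forall>t\<in>T. u (Suc k) t \<ominus>\<^bsub>A\<^esub> u k t \<in> aug_pow K A (n + k))"
proof (rule dependent_nat_choice)
  have rc: "r t \<in> carrier A" if "t \<in> T" for t
    using gen that mem_aug_ideal_iff unfolding generates_aug_ideal_def by blast
  \<comment> \<open>Zero coefficients start the recursion: the remainder is then
    \<open>a (Suc n)\<close> itself, which lies in \<open>I^(n+1)\<close> by hypothesis.\<close>
  have "(\<Oplus>\<^bsub>A\<^esub>t\<in>T. \<zero>\<^bsub>A\<^esub> \<otimes>\<^bsub>A\<^esub> r t) = (\<Oplus>\<^bsub>A\<^esub>t\<in>T. \<zero>\<^bsub>A\<^esub>)"
    using rc by (intro finsum_cong') auto
  then have "a (Suc (n + 0)) \<ominus>\<^bsub>A\<^esub> (\<Oplus>\<^bsub>A\<^esub>t\<in>T. \<zero>\<^bsub>A\<^esub> \<otimes>\<^bsub>A\<^esub> r t) \<in> aug_pow K A (Suc (n + 0))"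
    using a by (simp add: cauchy_closed a_minus_def)
  then show "\<exists>u. u \<in> T \<rightarrow> aug_pow K A n \<and>
      a (Suc (n + 0)) \<ominus>\<^bsub>A\<^esub> (\<Oplus>\<^bsub>A\<^esub>t\<in>T. u t \<otimes>\<^bsub>A\<^esub> r t) \<in> aug_pow K A (Suc (n + 0))"
    using aug_pow_zero_closed by (intro exI[of _ "\<lambda>_. \<zero>\<^bsub>A\<^esub>"]) simp
next
  fix u k
  have rc: "r t \<in> carrier A" if "t \<in> T" for t
    using gen that mem_aug_ideal_iff unfolding generates_aug_ideal_def by blast
  define S where "S v = (\<Oplus>\<^bsub>A\<^esub>t\<in>T. v t \<otimes>\<^bsub>A\<^esub> r t)" for v
  assume "u \<in> T \<rightarrow> aug_pow K A n \<and>
      a (Suc (n + k)) \<ominus>\<^bsub>A\<^esub> (\<Oplus>\<^bsub>A\<^esub>t\<in>T. u t \<otimes>\<^bsub>A\<^esub> r t) \<in> aug_pow K A (Suc (n + k))"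
  then have u: "u \<in> T \<rightarrow> aug_pow K A n"
    and au: "a (Suc (n + k)) \<ominus>\<^bsub>A\<^esub> S u \<in> aug_pow K A (Suc (n + k))"
    by (auto simp: S_def)
  have uc: "u t \<in> carrier A" if "t \<in> T" for t
    using u that aug_pow_closed by blast
  have ur: "(\<lambda>t. u t \<otimes>\<^bsub>A\<^esub> r t) \<in> T \<rightarrow> carrier A"
    using uc rc by auto
  have Su: "S u \<in> carrier A"
    unfolding S_def using ur by (rule finsum_closed)
  \<comment> \<open>This is what the old coefficients leave of the next term. It splits into a
    Cauchy difference and the old remainder, both in \<open>I^(n+k+1)\<close>.\<close>
  let ?x = "a (Suc (n + Suc k)) \<ominus>\<^bsub>A\<^esub> S u"
  have ac: "a m \<in> carrier A" for m
    using a(1) by (rule cauchy_closed)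
  have "a (Suc (n + Suc k)) \<ominus>\<^bsub>A\<^esub> a (Suc (n + k)) \<in> aug_pow K A (Suc (n + k))"
    using a(1) by (simp add: cauchy_def)
  moreover have "?x = (a (Suc (n + Suc k)) \<ominus>\<^bsub>A\<^esub> a (Suc (n + k))) \<oplus>\<^bsub>A\<^esub> (a (Suc (n + k)) \<ominus>\<^bsub>A\<^esub> S u)"
    using ac[of "Suc (n + Suc k)"] ac[of "Suc (n + k)"] Su by algebra
  ultimately have "?x \<in> aug_pow K A (Suc (n + k))"
    using aug_pow_add_closed au by simp
  \<comment> \<open>The correction \<open>e\<close> takes values in \<open>I^(n+k)\<close>, which
    makes the coefficients converge, while the new remainder gains one order.\<close>
  then obtain e where e: "e \<in> T \<rightarrow> aug_pow K A (n + k)"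
    "?x \<ominus>\<^bsub>A\<^esub> S e \<in> aug_pow K A (Suc (Suc (n + k)))"
    using aug_pow_Suc_expansion[OF gen] unfolding S_def by blast
  have ec: "e t \<in> carrier A" if "t \<in> T" for t
    using e that aug_pow_closed by blast
  have er: "(\<lambda>t. e t \<otimes>\<^bsub>A\<^esub> r t) \<in> T \<rightarrow> carrier A"
    using ec rc by auto
  have Se: "S e \<in> carrier A"
    unfolding S_def using er by (rule finsum_closed)
  define v where "v = (\<lambda>t. u t \<oplus>\<^bsub>A\<^esub> e t)"
  have "S v = (\<Oplus>\<^bsub>A\<^esub>t\<in>T. u t \<otimes>\<^bsub>A\<^esub> r t \<oplus>\<^bsub>A\<^esub> e t \<otimes>\<^bsub>A\<^esub> r t)"
    unfolding S_def v_def using uc ec rc ur er by (intro finsum_cong') (auto simp: l_distr Pi_iff)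
  also have "\<dots> = S u \<oplus>\<^bsub>A\<^esub> S e"
    unfolding S_def using ur er by (rule finsum_addf)
  finally have "a (Suc (n + Suc k)) \<ominus>\<^bsub>A\<^esub> S v = ?x \<ominus>\<^bsub>A\<^esub> S e"
    using ac[of "Suc (n + Suc k)"] Su Se by (simp add: a_minus_def minus_add a_ac)
  then have "a (Suc (n + Suc k)) \<ominus>\<^bsub>A\<^esub> S v \<in> aug_pow K A (Suc (n + Suc k))"
    using e(2) by simp
  moreover have "e t \<in> aug_pow K A n" if "t \<in> T" for t
    using e(1) aug_pow_antimono[of n "n + k"] that by auto
  then have "v \<in> T \<rightarrow> aug_pow K A n"
    using u aug_pow_add_closed unfolding v_def by blast
  moreover have "v t \<ominus>\<^bsub>A\<^esub> u t \<in> aug_pow K A (n + k)" if t: "t \<in> T" for t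
  proof -
    have "v t \<ominus>\<^bsub>A\<^esub> u t = e t"
      unfolding v_def using uc[OF t] ec[OF t] by algebra
    then show ?thesis
      using e(1) t by auto
  qed
  ultimately show "\<exists>v. (v \<in> T \<rightarrow> aug_pow K A n \<and>
      a (Suc (n + Suc k)) \<ominus>\<^bsub>A\<^esub> (\<Oplus>\<^bsub>A\<^esub>t\<in>T. v t \<otimes>\<^bsub>A\<^esub> r t) \<in> aug_pow K A (Suc (n + Suc k))) \<and>
      (\<forall>t\<in>T. v t \<ominus>\<^bsub>A\<^esub> u t \<in> aug_pow K A (n + k))"
    unfolding S_def by blast
qed

text \<open>The reverse inclusion climbs one power at a time: an element of \<open>J_(n+1)\<close>
  is a finite sum of products whose left factors lie in \<open>J_n\<close>, hence in the
  \<open>n\<close>-th power by induction, and whose right factors are classes of the constant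
  sequences \<open>r t\<close>, which lie in the augmentation ideal.\<close>

theorem aug_pow_completion:
  assumes "finite_type K A"
  shows "aug_pow K (completion K A) n = {f \<in> carrier (completion K A). f n = aug_pow K A n}"
proof
  show "aug_pow K (completion K A) n \<subseteq> {f \<in> carrier (completion K A). f n = aug_pow K A n}"
    by (rule aug_pow_completion_subset)
  let ?C = "completion K A"
  interpret C: augmented_algebra K ?C
    by (rule augmented_completion)
  obtain T :: "'a set set" and r where gen: "generates_aug_ideal T r"
    by (rule finite_type_generators[OF assms])
  then have T: "finite T" and r: "r \<in> T \<rightarrow> aug_ideal K A"
    by (auto simp: generates_aug_ideal_def)
  have rc: "r t \<in> carrier A" if "t \<in> T" for t
    using gen that mem_aug_ideal_iff unfolding generates_aug_ideal_def by blast
  show "{f \<in> carrier ?C. f n = aug_pow K A n} \<subseteq> aug_pow K ?C n"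
  proof (induction n)
    case 0
    then show ?case
      by auto
  next
    case (Suc n)
    show ?case
    proof
      fix f assume "f \<in> {f \<in> carrier ?C. f (Suc n) = aug_pow K A (Suc n)}"
      then obtain a where a: "cauchy a" "f = seq_class a" "a (Suc n) \<in> aug_pow K A (Suc n)"
        using seq_class_zero_iff by (auto simp: completion_rep)
      obtain u where u: "\<And>k. u k \<in> T \<rightarrow> aug_pow K A n"
        and au: "\<And>k. a (Suc (n + k)) \<ominus>\<^bsub>A\<^esub> (\<Oplus>\<^bsub>A\<^esub>t\<in>T. u k t \<otimes>\<^bsub>A\<^esub> r t) \<in> aug_pow K A (Suc (n + k))"
        and du: "\<And>k t. t \<in> T \<Longrightarrow> u (Suc k) t \<ominus>\<^bsub>A\<^esub> u k t \<in> aug_pow K A (n + k)"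
        using cauchy_expansion[OF gen a(1,3)] by blast
      \<comment> \<open>The differences of the \<open>u k\<close> are controlled by
        \<open>I^(n+k)\<close>, so the term of index \<open>m\<close> is taken from
        \<open>k = m - n\<close>. Truncated subtraction keeps the sequence constant up to index
        \<open>n\<close>.\<close>
      define b where "b t m = u (m - n) t" for t m
      have bI: "b t m \<in> aug_pow K A n" if "t \<in> T" for t m
        unfolding b_def using u that by blast
      have bc: "b t m \<in> carrier A" if "t \<in> T" for t m
        using bI[OF that] aug_pow_closed by blast
      have cb: "cauchy (b t)" if t: "t \<in> T" for t
        unfolding cauchy_def
      proof (intro conjI allI)
        fix m
        show "b t m \<in> carrier A"
          using t by (rule bc)
        show "b t (Suc m) \<ominus>\<^bsub>A\<^esub> b t m \<in> aug_pow K A m"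
        proof (cases "n \<le> m")
          case True
          then show ?thesis
            using du[OF t, of "m - n"] by (simp add: b_def Suc_diff_le)
        next
          case False
          then have "b t (Suc m) = b t m"
            by (simp add: b_def)
          then show ?thesis
            using bc[OF t, of m] aug_pow_zero_closed by (simp add: a_minus_def r_neg)
        qed
      qed
      have cbr: "cauchy (\<lambda>m. b t m \<otimes>\<^bsub>A\<^esub> r t)" if "t \<in> T" for t
        using cauchy_mult[OF cb cauchy_const[OF rc]] that by simp
      define s where "s m = (\<Oplus>\<^bsub>A\<^esub>t\<in>T. b t m \<otimes>\<^bsub>A\<^esub> r t)" for m
      have s: "cauchy s" "(\<Oplus>\<^bsub>?C\<^esub>t\<in>T. seq_class (\<lambda>m. b t m \<otimes>\<^bsub>A\<^esub> r t)) = seq_class s"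
        using cauchy_finsum[OF T, of "\<lambda>t m. b t m \<otimes>\<^bsub>A\<^esub> r t"] cbr by (auto simp: s_def[abs_def])
      have as: "cauchy (\<lambda>m. a m \<ominus>\<^bsub>A\<^esub> s m)"
        using a(1) s(1) by (rule cauchy_minus)
      \<comment> \<open>The coefficients \<open>u m\<close> sit at index \<open>n + m\<close>, so
        the difference is estimated there and the result is carried back to index
        \<open>m\<close>.\<close>
      have "a m \<ominus>\<^bsub>A\<^esub> s m \<in> aug_pow K A m" for m
      proof -
        have "a (Suc (n + m)) \<ominus>\<^bsub>A\<^esub> (\<Oplus>\<^bsub>A\<^esub>t\<in>T. u m t \<otimes>\<^bsub>A\<^esub> r t) \<in> aug_pow K A m"
          using au[of m] aug_pow_antimono[of m "Suc (n + m)"] by auto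
        \<comment> \<open>The estimate for \<open>u m\<close> concerns
          \<open>a (Suc (n + m))\<close>, one index later than \<open>s (n + m)\<close>; the Cauchy
          condition bridges the gap.\<close>
        moreover have "a (n + m) \<ominus>\<^bsub>A\<^esub> a (Suc (n + m)) \<in> aug_pow K A m"
        proof -
          have "a (Suc (n + m)) \<ominus>\<^bsub>A\<^esub> a (n + m) \<in> aug_pow K A m"
            using a(1) aug_pow_antimono[of m "n + m"] by (auto simp: cauchy_def)
          moreover have "a (n + m) \<ominus>\<^bsub>A\<^esub> a (Suc (n + m)) = \<ominus>\<^bsub>A\<^esub> (a (Suc (n + m)) \<ominus>\<^bsub>A\<^esub> a (n + m))"
            using cauchy_closed[OF a(1), of "n + m"] cauchy_closed[OF a(1), of "Suc (n + m)"]
            by algebra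
          ultimately show ?thesis
            using aug_pow_inv_closed by simp
        qed
        moreover have "s (n + m) = (\<Oplus>\<^bsub>A\<^esub>t\<in>T. u m t \<otimes>\<^bsub>A\<^esub> r t)"
          by (simp add: s_def b_def)
        moreover have "a (n + m) \<ominus>\<^bsub>A\<^esub> s (n + m) =
            (a (n + m) \<ominus>\<^bsub>A\<^esub> a (Suc (n + m))) \<oplus>\<^bsub>A\<^esub> (a (Suc (n + m)) \<ominus>\<^bsub>A\<^esub> s (n + m))"
          using cauchy_closed[OF a(1), of "n + m"] cauchy_closed[OF a(1), of "Suc (n + m)"]
            cauchy_closed[OF s(1), of "n + m"] by algebra
        ultimately have "a (n + m) \<ominus>\<^bsub>A\<^esub> s (n + m) \<in> aug_pow K A m"
          using aug_pow_add_closed by simp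
        then show ?thesis
          using cauchy_mem_iff[OF as, of m "n + m"] by simp
      qed
      then have fs: "f = seq_class s"
        using a(1,2) s(1) by (simp add: fun_eq_iff seq_class_eq_iff)
      have "seq_class (\<lambda>m. b t m \<otimes>\<^bsub>A\<^esub> r t) \<in> aug_pow K ?C (Suc n)" if t: "t \<in> T" for t
      proof -
        have "seq_class (b t) \<in> aug_pow K ?C n"
          using Suc.IH cb[OF t] bI[OF t] seq_class_closed seq_class_zero_iff by blast
        moreover have "seq_class (\<lambda>_. r t) \<in> aug_ideal K ?C"
          using r t rc[OF t] seq_class_zero_iff[OF cauchy_const[OF rc[OF t]], of "Suc 0"]
          unfolding mem_aug_ideal_completion_iff aug_pow_1
          by (auto simp: seq_class_closed cauchy_const simp del: completion_simps)
        ultimately show ?thesis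
          using ideal_prod.prod[of "seq_class (b t)" _ "seq_class (\<lambda>_. r t)" _ ?C]
          by (simp add: aug_pow.simps(2) seq_class_mult cb[OF t] cauchy_const rc[OF t]
              del: completion_simps)
      qed
      \<comment> \<open>The sum stays in the power because \<open>T\<close> is finite.\<close>
      then show "f \<in> aug_pow K ?C (Suc n)"
        unfolding fs s(2)[symmetric] using T by (intro C.aug_pow_finsum_closed) auto
    qed
  qed
qed

text \<open>Once the powers are the \<open>J_n\<close>, strictness says when a constant sequence has
  zero component in \<open>A/I^n\<close>, and density is the approximation of a class by the terms
  of a representing sequence.\<close>

lemma strict_dense_completion_map:
  assumes "finite_type K A"
  shows "strict_dense_hom K A (completion K A) (completion_map K A)"
proof -
  let ?C = "completion K A"
  interpret C: augmented_algebra K ?C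
    by (rule augmented_completion)
  show ?thesis
  proof
    show "completion_map K A \<in> alg_hom K A ?C"
      by (rule completion_map_alg_hom)
  next
    fix x n assume "x \<in> carrier A"
    then show "completion_map K A x \<in> aug_pow K ?C n \<longleftrightarrow> x \<in> aug_pow K A n"
      by (simp add: aug_pow_completion[OF assms] completion_map_eq cauchy_const seq_class_closed
          seq_class_zero_iff)
  next
    fix f n assume "f \<in> carrier ?C"
    then obtain a where a: "cauchy a" "f = seq_class a"
      by (auto simp: completion_rep)
    \<comment> \<open>The witness for density is \<open>a n\<close>: subtracting it makes the term
      of index \<open>n\<close> vanish.\<close>
    have "cauchy (\<lambda>m. a m \<ominus>\<^bsub>A\<^esub> a n)"
      using a(1) by (intro cauchy_minus cauchy_const cauchy_closed)
    moreover have "a n \<ominus>\<^bsub>A\<^esub> a n \<in> aug_pow K A n"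
      using a(1) by (intro cauchy_diff) simp_all
    ultimately have "f \<ominus>\<^bsub>?C\<^esub> completion_map K A (a n) \<in> aug_pow K ?C n"
      using a by (simp add: aug_pow_completion[OF assms] completion_map_eq seq_class_minus
          cauchy_const cauchy_closed seq_class_closed seq_class_zero_iff)
    then show "\<exists>x\<in>carrier A. f \<ominus>\<^bsub>?C\<^esub> completion_map K A x \<in> aug_pow K ?C n"
      using a(1) cauchy_closed by blast
  qed
qed

section \<open>Completeness of the completion\<close>

text \<open>Since the powers of the augmentation ideal are the \<open>J_n\<close>, elements of the
  completion are separated by their classes modulo these powers, and a Cauchy sequence in the
  completion has its diagonal as limit.\<close>

theorem complete_completion:
  assumes "finite_type K A"
  shows "complete_aug_alg K (completion K A)"
proof -
  let ?C = "completion K A" and ?D = "completion K (completion K A)"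
  interpret C: augmented_algebra K ?C
    by (rule augmented_completion)
  \<comment> \<open>The identification of the powers enters here: congruence modulo the
    \<open>n\<close>-th power becomes equality of components at index \<open>n\<close>.\<close>
  have minus_mem: "f \<ominus>\<^bsub>?C\<^esub> g \<in> aug_pow K ?C n \<longleftrightarrow> f n = g n"
    if "f \<in> carrier ?C" "g \<in> carrier ?C" for f g n
  proof -
    obtain a b where "cauchy a" "f = seq_class a" "cauchy b" "g = seq_class b"
      using \<open>f \<in> _\<close> \<open>g \<in> _\<close> by (auto simp: completion_rep)
    then show ?thesis
      by (simp add: aug_pow_completion[OF assms] seq_class_minus cauchy_minus seq_class_closed
          seq_class_zero_iff seq_class_eq_iff)
  qed
  have "bij_betw (completion_map K ?C) (carrier ?C) (carrier ?D)"
  proof (rule bij_betwI')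
    fix f g assume "f \<in> carrier ?C" "g \<in> carrier ?C"
    then show "completion_map K ?C f = completion_map K ?C g \<longleftrightarrow> f = g"
      by (auto simp: completion_map_def fun_eq_iff C.coset_eq_iff[OF C.ideal_aug_pow] minus_mem)
  next
    fix f assume "f \<in> carrier ?C"
    then show "completion_map K ?C f \<in> carrier ?D"
      unfolding C.completion_map_eq by (intro C.seq_class_closed C.cauchy_const)
  next
    fix F assume "F \<in> carrier ?D"
    then obtain \<phi> where \<phi>: "C.cauchy \<phi>" "F = C.seq_class \<phi>"
      by (auto simp: C.completion_rep)
    have c: "\<phi> n \<in> carrier ?C" for n
      using \<phi>(1) by (rule C.cauchy_closed)
    \<comment> \<open>The Cauchy condition says that consecutive terms share the component of index
      \<open>n\<close>. Hence projecting the diagonal from index \<open>n + 1\<close> to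
      \<open>n\<close> gives the diagonal again.\<close>
    have step: "\<phi> (Suc n) n = \<phi> n n" for n
      using \<phi>(1) minus_mem[OF c c] by (simp add: C.cauchy_def)
    define g where "g n = \<phi> n n" for n
    have "g n \<in> carrier (alg_quot A (aug_pow K A n))" for n
      using c[of n] by (simp add: g_def completion_def)
    moreover have "quot_map A (aug_pow K A n) (\<lambda>x. x) (g (Suc n)) = g n" for n
      using c[of "Suc n"] step[of n] by (simp add: g_def completion_def)
    ultimately have g: "g \<in> carrier ?C"
      by (simp add: completion_def)
    \<comment> \<open>The diagonal \<open>g\<close> and the term \<open>\<phi> n\<close> have the
      same component of index \<open>n\<close>, so they define the same coset of the
      \<open>n\<close>-th power.\<close>
    have "F = completion_map K ?C g"
      using c g unfolding \<phi>(2) C.completion_map_eq C.seq_class_def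
      by (auto simp: fun_eq_iff C.coset_eq_iff[OF C.ideal_aug_pow] minus_mem g_def)
    then show "\<exists>g\<in>carrier ?C. F = completion_map K ?C g"
      using g by blast
  qed
  then show ?thesis
    using C.completion_map_alg_hom C.aug_completion_map
    by (simp add: complete_aug_alg_def C.augmented_algebra_axioms aug_alg_iso_def alg_iso_def)
qed

end

theorem theorem1p10:
  fixes K :: "('k, 'r) ring_scheme" and A :: "('k, 'a, 'm) aug_alg_scheme"
  assumes "cring K" and "augmented_algebra K A" and "finite_type K A"
  shows "complete_aug_alg K (completion K A) \<and>
    (\<forall>n\<ge>1. quot_map (completion K A) (aug_pow K (completion K A) n) (completion_map K A)
        \<in> alg_iso K (alg_quot A (aug_pow K A n))
            (alg_quot (completion K A) (aug_pow K (completion K A) n))) \<and>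
    gr_map K (completion K A) (completion_map K A)
        \<in> alg_iso K (gr_alg K A) (gr_alg K (completion K A)) \<and>
    finite_type K (completion K A)"
proof -
  interpret A: augmented_algebra K A
    by fact
  \<comment> \<open>This supplies the claims on quotients, graded algebras and finite type;
    completeness was obtained from the diagonal argument.\<close>
  interpret strict_dense_hom K A "completion K A" "completion_map K A"
    using assms(3) by (rule A.strict_dense_completion_map)
  show ?thesis
    using A.complete_completion[OF assms(3)] alg_quot_iso gr_iso finite_type_transfer[OF assms(3)]
    by blast
qed

end
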